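(* Every Bézout duo-domain of Gelfand range 1 is an elementary divisor ring.
   Context: All rings are associative with an identity, not necessarily commutative. A matrix $A$ (not necessarily square) over a ring $R$ admits diagonal reduction if there exist invertible matrices $P$ and $Q$ over $R$ such that $PAQ$ is a diagonal matrix $(d_{ij})$ with $Rd_{(i+1)(i+1)}R\subseteq d_{ii}R\cap Rd_{ii}$ for each $i$. A ring $R$ is an elementary divisor ring if every matrix over $R$ admits a diagonal reduction. A ring is a Bézout ring if every finitely generated right ideal and every finitely generated left ideal is principal. A ring is duo if every right ideal and every left ideal is a two-sided ideal. A domain is a ring with no nonzero zero divisors (not necessarily commutative). A Bézout duo-domain is a ring that is Bézout, duo and a domain. A ring is a PM ring if every prime ideal is contained in only one maximal ideal. An element $a$ of a Bézout duo-domain $R$ is PM if $R/aR$ is a PM ring. A Bézout duo-domain $R$ has Gelfand range 1 if whenever $aR+bR=R$ with $a,b\in R$ there exists $y\in R$ such that $a+by$ is PM. *)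

theory Defs
  imports
    "HOL-Algebra.Ideal_Product"
    "HOL-Algebra.QuotRing"
    "Jordan_Normal_Form.Matrix"
begin

text \<open>Rings are rings with identity in the sense of the locale \<^locale>\<open>ring\<close>; they need not be
  commutative, and the zero ring is allowed.  Since \<^const>\<open>l_coset\<close> and \<^const>\<open>r_coset\<close> refer to the
  multiplication of the ring, \<open>a <#\<^bsub>R\<^esub> carrier R\<close> is the principal right ideal $aR$ and
  \<open>carrier R #>\<^bsub>R\<^esub> a\<close> is the principal left ideal $Ra$.\<close>

section \<open>One-sided ideals, Bezout rings, duo rings\<close>

definition right_ideal :: "'a set \<Rightarrow> ('a, 'b) ring_scheme \<Rightarrow> bool" where
  "right_ideal I R \<longleftrightarrow> ring R \<and> additive_subgroup I R \<and>
     (\<forall>a\<in>I. \<forall>x\<in>carrier R. a \<otimes>\<^bsub>R\<^esub> x \<in> I)"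

definition left_ideal :: "'a set \<Rightarrow> ('a, 'b) ring_scheme \<Rightarrow> bool" where
  "left_ideal I R \<longleftrightarrow> ring R \<and> additive_subgroup I R \<and>
     (\<forall>a\<in>I. \<forall>x\<in>carrier R. x \<otimes>\<^bsub>R\<^esub> a \<in> I)"

definition right_ideal_gen :: "('a, 'b) ring_scheme \<Rightarrow> 'a set \<Rightarrow> 'a set" where
  "right_ideal_gen R S = \<Inter>{I. right_ideal I R \<and> S \<subseteq> I}"

definition left_ideal_gen :: "('a, 'b) ring_scheme \<Rightarrow> 'a set \<Rightarrow> 'a set" where
  "left_ideal_gen R S = \<Inter>{I. left_ideal I R \<and> S \<subseteq> I}"

definition bezout_ring :: "('a, 'b) ring_scheme \<Rightarrow> bool" where
  "bezout_ring R \<longleftrightarrow> ring R \<and>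
     (\<forall>S. finite S \<longrightarrow> S \<subseteq> carrier R \<longrightarrow>
        (\<exists>a\<in>carrier R. right_ideal_gen R S = a <#\<^bsub>R\<^esub> carrier R)) \<and>
     (\<forall>S. finite S \<longrightarrow> S \<subseteq> carrier R \<longrightarrow>
        (\<exists>a\<in>carrier R. left_ideal_gen R S = carrier R #>\<^bsub>R\<^esub> a))"

definition duo_ring :: "('a, 'b) ring_scheme \<Rightarrow> bool" where
  "duo_ring R \<longleftrightarrow> ring R \<and>
     (\<forall>I. right_ideal I R \<longrightarrow> ideal I R) \<and>
     (\<forall>I. left_ideal I R \<longrightarrow> ideal I R)"

text \<open>The locale \<^locale>\<open>domain\<close> of the library is restricted to commutative rings.\<close>

definition nc_domain :: "('a, 'b) ring_scheme \<Rightarrow> bool" where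
  "nc_domain R \<longleftrightarrow> ring R \<and>
     (\<forall>a\<in>carrier R. \<forall>b\<in>carrier R.
        a \<otimes>\<^bsub>R\<^esub> b = \<zero>\<^bsub>R\<^esub> \<longrightarrow> a = \<zero>\<^bsub>R\<^esub> \<or> b = \<zero>\<^bsub>R\<^esub>)"

definition bezout_duo_domain :: "('a, 'b) ring_scheme \<Rightarrow> bool" where
  "bezout_duo_domain R \<longleftrightarrow> bezout_ring R \<and> duo_ring R \<and> nc_domain R"

section \<open>PM rings, PM elements and Gelfand range 1\<close>

text \<open>The locale \<^locale>\<open>primeideal\<close> of the library is restricted to commutative rings; this is the
  usual notion for arbitrary rings, in terms of products of two-sided ideals.\<close>

definition nc_primeideal :: "'a set \<Rightarrow> ('a, 'b) ring_scheme \<Rightarrow> bool" where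
  "nc_primeideal P R \<longleftrightarrow> ideal P R \<and> P \<noteq> carrier R \<and>
     (\<forall>I J. ideal I R \<longrightarrow> ideal J R \<longrightarrow> ideal_prod R I J \<subseteq> P \<longrightarrow> I \<subseteq> P \<or> J \<subseteq> P)"

definition PM_ring :: "('a, 'b) ring_scheme \<Rightarrow> bool" where
  "PM_ring R \<longleftrightarrow> ring R \<and>
     (\<forall>P. nc_primeideal P R \<longrightarrow> (\<exists>!M. maximalideal M R \<and> P \<subseteq> M))"

definition PM_element :: "('a, 'b) ring_scheme \<Rightarrow> 'a \<Rightarrow> bool" where
  "PM_element R a \<longleftrightarrow> a \<in> carrier R \<and> PM_ring (R Quot (a <#\<^bsub>R\<^esub> carrier R))"

definition gelfand_range_1 :: "('a, 'b) ring_scheme \<Rightarrow> bool" where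
  "gelfand_range_1 R \<longleftrightarrow>
     (\<forall>a\<in>carrier R. \<forall>b\<in>carrier R.
        (a <#\<^bsub>R\<^esub> carrier R) <+>\<^bsub>R\<^esub> (b <#\<^bsub>R\<^esub> carrier R) = carrier R \<longrightarrow>
        (\<exists>y\<in>carrier R. PM_element R (a \<oplus>\<^bsub>R\<^esub> b \<otimes>\<^bsub>R\<^esub> y)))"

section \<open>Matrices over a ring and diagonal reduction\<close>

text \<open>The matrix type is the library's, but its arithmetic is that of a type class, so the operations
  are redefined with those of the ring structure \<open>R\<close>.\<close>

definition mats_over :: "('a, 'b) ring_scheme \<Rightarrow> nat \<Rightarrow> nat \<Rightarrow> 'a mat set" where
  "mats_over R m n = {A \<in> carrier_mat m n. elements_mat A \<subseteq> carrier R}"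

definition mat_mult_over :: "('a, 'b) ring_scheme \<Rightarrow> 'a mat \<Rightarrow> 'a mat \<Rightarrow> 'a mat" where
  "mat_mult_over R A B = mat (dim_row A) (dim_col B)
     (\<lambda>(i, j). \<Oplus>\<^bsub>R\<^esub>k\<in>{..<dim_col A}. A $$ (i, k) \<otimes>\<^bsub>R\<^esub> B $$ (k, j))"

definition one_mat_over :: "('a, 'b) ring_scheme \<Rightarrow> nat \<Rightarrow> 'a mat" where
  "one_mat_over R n = mat n n (\<lambda>(i, j). if i = j then \<one>\<^bsub>R\<^esub> else \<zero>\<^bsub>R\<^esub>)"

definition invertible_mat_over :: "('a, 'b) ring_scheme \<Rightarrow> nat \<Rightarrow> 'a mat \<Rightarrow> bool" where
  "invertible_mat_over R n P \<longleftrightarrow> P \<in> mats_over R n n \<and>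
     (\<exists>P'\<in>mats_over R n n. mat_mult_over R P P' = one_mat_over R n \<and>
                           mat_mult_over R P' P = one_mat_over R n)"

text \<open>Below, \<open>Idl\<^bsub>R\<^esub> {d}\<close> is the two-sided ideal $RdR$.\<close>

definition diagonal_divisor_mat :: "('a, 'b) ring_scheme \<Rightarrow> 'a mat \<Rightarrow> bool" where
  "diagonal_divisor_mat R D \<longleftrightarrow>
     (\<forall>i<dim_row D. \<forall>j<dim_col D. i \<noteq> j \<longrightarrow> D $$ (i, j) = \<zero>\<^bsub>R\<^esub>) \<and>
     (\<forall>i. Suc i < min (dim_row D) (dim_col D) \<longrightarrow>
        Idl\<^bsub>R\<^esub> {D $$ (Suc i, Suc i)}
          \<subseteq> (D $$ (i, i) <#\<^bsub>R\<^esub> carrier R) \<inter> (carrier R #>\<^bsub>R\<^esub> D $$ (i, i)))"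

definition admits_diagonal_reduction :: "('a, 'b) ring_scheme \<Rightarrow> 'a mat \<Rightarrow> bool" where
  "admits_diagonal_reduction R A \<longleftrightarrow>
     (\<exists>P Q. invertible_mat_over R (dim_row A) P \<and> invertible_mat_over R (dim_col A) Q \<and>
        diagonal_divisor_mat R (mat_mult_over R (mat_mult_over R P A) Q))"

definition elementary_divisor_ring :: "('a, 'b) ring_scheme \<Rightarrow> bool" where
  "elementary_divisor_ring R \<longleftrightarrow> ring R \<and>
     (\<forall>m n. \<forall>A\<in>mats_over R m n. admits_diagonal_reduction R A)"

end

theory Submission
  imports Defs "HOL-Algebra.Ring_Divisibility"
begin

text \<open>
  Write \<open>x \<bowtie> y\<close> for \<open>xR + yR = R\<close>.  As for commutative rings, everything reduces to triangular
  matrices with rows \<open>(a, 0)\<close> and \<open>(b, c)\<close> and comaximal entries, for which one needs \<open>u\<close>, \<open>q\<close>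
  with \<open>a u \<bowtie> b u + c q\<close>; Gelfand range 1 allows assuming that \<open>b\<close> is PM.  Write \<open>b = g b1\<close>,
  \<open>c = g c1\<close> with \<open>b1 \<bowtie> c1\<close>, so that \<open>a \<bowtie> g\<close>.  Since no prime ideal containing \<open>b\<close> lies in
  maximal ideals containing \<open>a\<close> and \<open>g\<close> respectively, \<open>b1\<close> is a product of factors each of which is
  comaximal with \<open>a\<close> or with \<open>g\<close>.

  For commutative rings the factors can be sorted.  In a duo ring, moving a factor past another one
  conjugates it, and conjugation may permute the maximal ideals.  Sorting is however possible modulo
  \<open>c1\<close>: \<open>R\<close> has stable range two, so any two factors of different kind have comaximal
  representatives modulo \<open>c1\<close> of the same kind, and comaximal elements commute up to a unit.  Thus
  \<open>b1\<close> is congruent to \<open>e v\<close> modulo \<open>c1\<close> with \<open>e \<bowtie> a\<close> and \<open>v \<bowtie> g\<close>.  Choosing \<open>u\<close> inverse to \<open>v\<close> modulo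
  \<open>g c1\<close> and comaximal with \<open>e\<close> gives \<open>b u + c q = g e\<close>, which is comaximal with \<open>a u\<close>.
\<close>

section \<open>Prime and maximal ideals\<close>

context ring
begin

text \<open>Zorn's lemma on the ideals above \<open>I\<close> that avoid \<open>S\<close>: the union
  of a nonempty chain stays in this family. With \<open>S\<close> = {1} the result is a maximal
  ideal, with \<open>S\<close> the monoid of comaximal products a completely prime one.\<close>

lemma ideal_maximal_disjoint:
  assumes "ideal I R" "I \<inter> S = {}"
  obtains P where "ideal P R" "I \<subseteq> P" "P \<inter> S = {}"
    "\<And>J. \<lbrakk>ideal J R; P \<subseteq> J; J \<inter> S = {}\<rbrakk> \<Longrightarrow> J = P"
proof -
  let ?A = "{J. ideal J R \<and> I \<subseteq> J \<and> J \<inter> S = {}}"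
  have "\<exists>M\<in>?A. \<forall>X\<in>?A. M \<subseteq> X \<longrightarrow> X = M"
  proof (rule subset_Zorn_nonempty)
    show "?A \<noteq> {}" using assms by blast
    fix C assume C: "C \<noteq> {}" "subset.chain ?A C"
    then have sub: "C \<subseteq> ?A" and "subset.chain {J. ideal J R} C"
      unfolding pred_on.chain_def by blast+
    then have "ideal (\<Union>C) R" using chain_Union_is_ideal[of C] C(1) by simp
    moreover obtain J where "J \<in> C" using C(1) by blast
    then have "I \<subseteq> \<Union>C" using subsetD[OF sub, of J] by blast
    moreover have "J \<inter> S = {}" if "J \<in> C" for J using subsetD[OF sub that] by simp
    then have "\<Union>C \<inter> S = {}" by blast
    ultimately show "\<Union>C \<in> ?A" by blast
  qed
  then obtain P where "P \<in> ?A" "\<forall>X\<in>?A. P \<subseteq> X \<longrightarrow> X = P" by (rule bexE)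
  then show ?thesis by (intro that[of P]) auto
qed

lemma maximalideal_exists:
  assumes "ideal I R" "\<one> \<notin> I"
  obtains M where "maximalideal M R" "I \<subseteq> M"
proof -
  obtain M where M: "ideal M R" "I \<subseteq> M" "M \<inter> {\<one>} = {}"
    "\<And>J. \<lbrakk>ideal J R; M \<subseteq> J; J \<inter> {\<one>} = {}\<rbrakk> \<Longrightarrow> J = M"
    using ideal_maximal_disjoint[OF assms(1), of "{\<one>}"] assms(2) by blast
  have "maximalideal M R"
  proof (rule maximalidealI[OF M(1)])
    show "carrier R \<noteq> M" using M(3) by auto
    show "J = M \<or> J = carrier R" if "ideal J R" "M \<subseteq> J" for J
      using M(4)[OF that] ideal.one_imp_carrier[OF that(1)] by blast
  qed
  then show ?thesis using that M(2) by blast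
qed

text \<open>Ideals of \<open>R Quot I\<close> correspond to ideals of \<open>R\<close> above
  \<open>I\<close>, and the correspondence carries \<open>P\<close> to a prime ideal and
  \<open>M\<close>, \<open>N\<close> to maximal ideals above it. Primality of \<open>P\<close> is
  assumed elementwise, which yields primality in terms of ideal products in the quotient.\<close>

lemma quotient_PM_unique_maximal:
  assumes I: "ideal I R" and PM: "PM_ring (R Quot I)"
    and P: "ideal P R" "I \<subseteq> P" "P \<noteq> carrier R"
    and prime: "\<And>x y. \<lbrakk>x \<in> carrier R; y \<in> carrier R; x \<otimes> y \<in> P\<rbrakk> \<Longrightarrow> x \<in> P \<or> y \<in> P"
    and M: "maximalideal M R" "P \<subseteq> M" and N: "maximalideal N R" "P \<subseteq> N"
  shows "M = N"
proof -
  let ?Q = "R Quot I" and ?f = "\<lambda>J. (+>) I ` J"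
  \<comment> \<open>Taking the union of the cosets inverts \<open>?f\<close> on ideals above
    \<open>I\<close>.\<close>
  have UN: "\<Union>(?f J) = J" if "ideal J R" "I \<subseteq> J" for J
    using that ideal_incl_iff[OF I that(1)] by simp
  have f: "ideal (?f J) ?Q" if "ideal J R" for J
    using ring_ideal_imp_quot_ideal[OF I that] .
  have carr: "carrier ?Q = ?f (carrier R)"
    by (auto simp: FactRing_def A_RCOSETS_def')
  have inv: "ideal (\<Union>K) R" "I \<subseteq> \<Union>K" "?f (\<Union>K) = K" if "ideal K ?Q" for K
  proof -
    show "ideal (\<Union>K) R" using quot_ideal_imp_ring_ideal[OF I that] .
    have "K \<in> ?f ` {J. ideal J R \<and> I \<subseteq> J}"
      using that quot_ideal_correspondence[OF I] by (simp add: bij_betw_def)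
    then obtain J where "ideal J R" "I \<subseteq> J" "K = ?f J" by blast
    then show "I \<subseteq> \<Union>K" "?f (\<Union>K) = K" using UN by auto
  qed
  have neq: "?f J \<noteq> carrier ?Q" if "ideal J R" "I \<subseteq> J" "J \<noteq> carrier R" for J
  proof
    assume "?f J = carrier ?Q"
    then have "\<Union>(?f J) = \<Union>(?f (carrier R))" using carr by simp
    moreover have "I \<subseteq> carrier R" using ideal.Icarr[OF I] by blast
    ultimately show False using UN[OF that(1,2)] UN[OF oneideal] that(3) by simp
  qed
  have max: "maximalideal (?f J) ?Q" if "maximalideal J R" "I \<subseteq> J" for J
  proof -
    interpret J: maximalideal J R by fact
    show ?thesis
    proof (rule maximalidealI)
      show "ideal (?f J) ?Q" using f J.is_ideal .
      show "carrier ?Q \<noteq> ?f J" using neq[OF J.is_ideal that(2)] J.I_notcarr by auto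
      fix K assume K: "ideal K ?Q" "?f J \<subseteq> K"
      have "J \<subseteq> \<Union>K" using Union_mono[OF K(2)] UN[OF J.is_ideal that(2)] by simp
      then have "\<Union>K = J \<or> \<Union>K = carrier R"
        using J.I_maximal[OF inv(1)[OF K(1)]] ideal.Icarr[OF inv(1)[OF K(1)]] by blast
      then show "K = ?f J \<or> K = carrier ?Q" using inv(3)[OF K(1)] carr by auto
    qed
  qed
  have "nc_primeideal (?f P) ?Q"
    unfolding nc_primeideal_def
  proof (intro conjI allI impI)
    show "ideal (?f P) ?Q" "?f P \<noteq> carrier ?Q" using f P neq by auto
    \<comment> \<open>If neither factor lay in the image of \<open>P\<close>, representatives of two
      cosets outside it would have their product in \<open>P\<close>, against
      \<open>prime\<close>.\<close>
    fix K L assume KL: "ideal K ?Q" "ideal L ?Q" "ideal_prod ?Q K L \<subseteq> ?f P"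
    show "K \<subseteq> ?f P \<or> L \<subseteq> ?f P"
    proof (rule ccontr)
      assume "\<not> (K \<subseteq> ?f P \<or> L \<subseteq> ?f P)"
      then obtain k l where kl: "k \<in> K" "l \<in> L" "k \<notin> ?f P" "l \<notin> ?f P" by blast
      obtain x y where xy: "x \<in> carrier R" "y \<in> carrier R" "k = I +> x" "l = I +> y"
        using ideal.Icarr[OF KL(1) kl(1)] ideal.Icarr[OF KL(2) kl(2)] unfolding carr
        by (elim imageE)
      have "k \<otimes>\<^bsub>?Q\<^esub> l \<in> ?f P" using KL(3) ideal_prod.prod[OF kl(1,2)] by blast
      then have "I +> (x \<otimes> y) \<in> ?f P"
        using ideal.rcoset_mult_add[OF I xy(1,2)] xy by (simp add: FactRing_def)
      moreover have "?f P \<subseteq> carrier ?Q" using carr ideal.Icarr[OF P(1)] by auto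
      ultimately have "x \<otimes> y \<in> \<Union>(?f P)"
        using canonical_proj_vimage_mem_iff[OF I, of "?f P" "x \<otimes> y"] xy by simp
      then have "x \<in> P \<or> y \<in> P" using prime[OF xy(1,2)] UN[OF P(1,2)] by simp
      then show False using kl xy by blast
    qed
  qed
  then have "\<exists>!M. maximalideal M ?Q \<and> ?f P \<subseteq> M" using PM unfolding PM_ring_def by blast
  moreover have "maximalideal (?f M) ?Q" "maximalideal (?f N) ?Q"
    using max M N P(2) by auto
  moreover have "?f P \<subseteq> ?f M" "?f P \<subseteq> ?f N" using M N by auto
  ultimately have "?f M = ?f N" by blast
  then have "\<Union>(?f M) = \<Union>(?f N)" by simp
  moreover have "\<Union>(?f M) = M" "\<Union>(?f N) = N"
    using UN[OF maximalideal.axioms(1)[OF M(1)]] UN[OF maximalideal.axioms(1)[OF N(1)]] M N P(2)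
    by simp_all
  ultimately show ?thesis by simp
qed

end

section \<open>Comaximal elements of a Bezout duo-domain\<close>

text \<open>The ring hypotheses in elementwise form: \<open>duo_right\<close> and
  \<open>duo_left\<close> say that \<open>Ra\<close> lies in \<open>aR\<close> and \<open>aR\<close>
  in \<open>Ra\<close>, while \<open>bezout\<close> supplies a generator \<open>d\<close> of
  \<open>aR + bR\<close> together with cofactors and coefficients.\<close>

locale bezout_duo = ring R for R (structure) +
  assumes duo_right: "\<lbrakk>a \<in> carrier R; x \<in> carrier R\<rbrakk> \<Longrightarrow> \<exists>y\<in>carrier R. x \<otimes> a = a \<otimes> y"
    and duo_left: "\<lbrakk>a \<in> carrier R; x \<in> carrier R\<rbrakk> \<Longrightarrow> \<exists>y\<in>carrier R. a \<otimes> x = y \<otimes> a"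
    and no_zero_div: "\<lbrakk>a \<in> carrier R; b \<in> carrier R; a \<otimes> b = \<zero>\<rbrakk> \<Longrightarrow> a = \<zero> \<or> b = \<zero>"
    and bezout: "\<lbrakk>a \<in> carrier R; b \<in> carrier R\<rbrakk> \<Longrightarrow>
      \<exists>d\<in>carrier R. \<exists>r\<in>carrier R. \<exists>s\<in>carrier R. \<exists>x\<in>carrier R. \<exists>y\<in>carrier R.
        a = d \<otimes> r \<and> b = d \<otimes> s \<and> a \<otimes> x \<oplus> b \<otimes> y = d"

definition comax :: "('a, 'b) ring_scheme \<Rightarrow> 'a \<Rightarrow> 'a \<Rightarrow> bool" where
  "comax R a b \<longleftrightarrow> a \<in> carrier R \<and> b \<in> carrier R \<and>
     (\<exists>x\<in>carrier R. \<exists>y\<in>carrier R. a \<otimes>\<^bsub>R\<^esub> x \<oplus>\<^bsub>R\<^esub> b \<otimes>\<^bsub>R\<^esub> y = \<one>\<^bsub>R\<^esub>)"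

text \<open>In a duo ring the choice of side is immaterial: \<open>dR = Rd\<close> turns a left
  factor into a right factor.\<close>

definition rdvd :: "('a, 'b) ring_scheme \<Rightarrow> 'a \<Rightarrow> 'a \<Rightarrow> bool" where
  "rdvd R d a \<longleftrightarrow> d \<in> carrier R \<and> (\<exists>x\<in>carrier R. a = d \<otimes>\<^bsub>R\<^esub> x)"

context bezout_duo
begin

abbreviation comaximal (infix "\<bowtie>" 50) where "a \<bowtie> b \<equiv> comax R a b"
abbreviation divides (infix "\<rightharpoonup>" 50) where "d \<rightharpoonup> a \<equiv> rdvd R d a"

section \<open>Divisibility and cancellation\<close>

lemma rdvd_carrier: "d \<rightharpoonup> a \<Longrightarrow> d \<in> carrier R \<and> a \<in> carrier R"
  by (auto simp: rdvd_def)

lemma rdvdI: "\<lbrakk>d \<in> carrier R; x \<in> carrier R\<rbrakk> \<Longrightarrow> d \<rightharpoonup> d \<otimes> x"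
  by (auto simp: rdvd_def)

lemma rdvdE:
  assumes "d \<rightharpoonup> a" obtains x where "d \<in> carrier R" "x \<in> carrier R" "a = d \<otimes> x"
  using assms by (auto simp: rdvd_def)

lemma rdvd_refl [simp]: "a \<in> carrier R \<Longrightarrow> a \<rightharpoonup> a"
  unfolding rdvd_def by (rule conjI, assumption, rule bexI[of _ \<one>]) auto

lemma rdvd_zero [simp]: "a \<in> carrier R \<Longrightarrow> a \<rightharpoonup> \<zero>"
  unfolding rdvd_def by (rule conjI, assumption, rule bexI[of _ \<zero>]) auto

lemma zero_rdvd [simp]: "\<zero> \<rightharpoonup> a \<longleftrightarrow> a = \<zero>"
  by (auto simp: rdvd_def)

lemma rdvd_mult_right: "\<lbrakk>d \<rightharpoonup> a; x \<in> carrier R\<rbrakk> \<Longrightarrow> d \<rightharpoonup> a \<otimes> x"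
  by (erule rdvdE) (simp add: m_assoc rdvdI)

lemma rdvd_trans: "\<lbrakk>d \<rightharpoonup> a; a \<rightharpoonup> b\<rbrakk> \<Longrightarrow> d \<rightharpoonup> b"
  by (erule rdvdE[of a]) (simp add: rdvd_mult_right)

lemma rdvd_mult_left:
  assumes "d \<rightharpoonup> a" "x \<in> carrier R" shows "d \<rightharpoonup> x \<otimes> a"
proof -
  obtain y where "y \<in> carrier R" "x \<otimes> a = a \<otimes> y"
    using duo_right[of a x] rdvd_carrier[OF assms(1)] assms(2) by blast
  then show ?thesis using assms rdvd_mult_right by simp
qed

lemma rdvd_add: "\<lbrakk>d \<rightharpoonup> a; d \<rightharpoonup> b\<rbrakk> \<Longrightarrow> d \<rightharpoonup> a \<oplus> b"
  by (elim rdvdE) (simp add: r_distr[symmetric] rdvdI)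

lemma rdvd_uminus: "d \<rightharpoonup> a \<Longrightarrow> d \<rightharpoonup> \<ominus> a"
  by (erule rdvdE) (simp add: r_minus[symmetric] rdvdI)

text \<open>This is the principal ideal \<open>dR\<close>, two-sided by the duo property, so that
  divisibility can be read as membership in an ideal.\<close>

lemma rdvd_ideal:
  assumes "d \<in> carrier R" shows "ideal {a. d \<rightharpoonup> a} R"
proof (intro idealI add.subgroupI ring_axioms)
  show "{a. d \<rightharpoonup> a} \<noteq> {}" using assms rdvd_zero by blast
  fix a x assume "a \<in> {a. d \<rightharpoonup> a}" "x \<in> carrier R"
  then show "a \<otimes> x \<in> {a. d \<rightharpoonup> a}" "x \<otimes> a \<in> {a. d \<rightharpoonup> a}"
    by (simp_all add: rdvd_mult_left rdvd_mult_right)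
next
  show "\<ominus> a \<in> {a. d \<rightharpoonup> a}" if "a \<in> {a. d \<rightharpoonup> a}" for a
    using that by (simp add: rdvd_uminus)
qed (auto simp: rdvd_add dest: rdvd_carrier)

lemma one_minus:
  assumes "p \<in> carrier R" "q \<in> carrier R" "p \<oplus> q = \<one>" shows "\<one> \<oplus> \<ominus> p = q"
  using assms by (metis a_comm a_assoc a_inv_closed r_neg r_zero)

lemma cancel_left:
  assumes "a \<in> carrier R" "x \<in> carrier R" "y \<in> carrier R" "a \<otimes> x = a \<otimes> y" "a \<noteq> \<zero>"
  shows "x = y"
proof -
  have "a \<otimes> (x \<ominus> y) = \<zero>" using assms by (simp add: minus_eq r_distr r_minus r_neg)
  then have "x \<ominus> y = \<zero>" using assms no_zero_div[of a "x \<ominus> y"] by simp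
  then show ?thesis using assms by simp
qed

lemma cancel_right:
  assumes "a \<in> carrier R" "x \<in> carrier R" "y \<in> carrier R" "x \<otimes> a = y \<otimes> a" "a \<noteq> \<zero>"
  shows "x = y"
proof -
  have "(x \<ominus> y) \<otimes> a = \<zero>" using assms by (simp add: minus_eq l_distr l_minus r_neg)
  then have "x \<ominus> y = \<zero>" using assms no_zero_div[of "x \<ominus> y" a] by simp
  then show ?thesis using assms by simp
qed

section \<open>Comaximality, Gauss's lemma and greatest common divisors\<close>

lemma comax_carrier: "a \<bowtie> b \<Longrightarrow> a \<in> carrier R \<and> b \<in> carrier R"
  by (simp add: comax_def)

lemma comaxE:
  assumes "a \<bowtie> b" obtains x y where "x \<in> carrier R" "y \<in> carrier R" "a \<otimes> x \<oplus> b \<otimes> y = \<one>"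
  using assms by (auto simp: comax_def)

lemma comax_sym: "a \<bowtie> b \<Longrightarrow> b \<bowtie> a"
  unfolding comax_def by (metis a_comm m_closed)

lemma comaxI:
  assumes "a \<in> carrier R" "b \<in> carrier R" "a \<rightharpoonup> r" "b \<rightharpoonup> s" "r \<oplus> s = \<one>"
  shows "a \<bowtie> b"
  using assms unfolding comax_def rdvd_def by auto

lemma comax_rdvd: "\<lbrakk>a \<bowtie> b; c \<rightharpoonup> b\<rbrakk> \<Longrightarrow> a \<bowtie> c"
  by (frule comax_carrier, elim comaxE rdvdE) (auto simp: comax_def m_assoc dest: comax_carrier)

lemma comax_one [simp]: "a \<in> carrier R \<Longrightarrow> a \<bowtie> \<one>"
  by (rule comaxI[of _ _ \<zero> \<one>]) auto

text \<open>Insert the Bezout identity of \<open>a\<close> and \<open>c\<close> between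
  \<open>b\<close> and \<open>y\<close> in that of \<open>a\<close> and \<open>b\<close>; by the duo
  property every term containing \<open>a\<close> is a multiple of \<open>a\<close>.\<close>

lemma comax_mult:
  assumes "a \<bowtie> b" "a \<bowtie> c" shows "a \<bowtie> b \<otimes> c"
proof -
  obtain x y where 1: "x \<in> carrier R" "y \<in> carrier R" "a \<otimes> x \<oplus> b \<otimes> y = \<one>"
    using assms(1) by (rule comaxE)
  obtain z w where 2: "z \<in> carrier R" "w \<in> carrier R" "a \<otimes> z \<oplus> c \<otimes> w = \<one>"
    using assms(2) by (rule comaxE)
  have c: "a \<in> carrier R" "b \<in> carrier R" "c \<in> carrier R" using assms comax_carrier by auto
  have "\<one> = a \<otimes> x \<oplus> b \<otimes> (a \<otimes> z \<oplus> c \<otimes> w) \<otimes> y" using 1 2 c by simp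
  also have "\<dots> = (a \<otimes> x \<oplus> b \<otimes> (a \<otimes> (z \<otimes> y))) \<oplus> (b \<otimes> c) \<otimes> (w \<otimes> y)"
    using 1(1,2) 2(1,2) c by (simp add: l_distr r_distr m_assoc a_assoc)
  finally show ?thesis
    using 1(1,2) 2(1,2) c by (intro comaxI[where r = "a \<otimes> x \<oplus> b \<otimes> (a \<otimes> (z \<otimes> y))"])
      (simp_all add: rdvd_add rdvdI rdvd_mult_left)
qed

lemma comax_multD:
  assumes "a \<bowtie> b \<otimes> c" "b \<in> carrier R" "c \<in> carrier R" shows "a \<bowtie> b" "a \<bowtie> c"
  by (rule comax_rdvd[OF assms(1)], simp add: assms rdvdI)
     (rule comax_rdvd[OF assms(1)], simp add: assms rdvd_mult_left)

text \<open>The term \<open>z y\<close> by which the Bezout sum changes is a multiple of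
  \<open>a\<close> and can be subtracted from \<open>a x\<close>.\<close>

lemma comax_cong:
  assumes "a \<bowtie> b" "a \<rightharpoonup> z" shows "a \<bowtie> b \<oplus> z"
proof -
  obtain x y where 1: "x \<in> carrier R" "y \<in> carrier R" "a \<otimes> x \<oplus> b \<otimes> y = \<one>"
    using assms(1) by (rule comaxE)
  have c: "a \<in> carrier R" "b \<in> carrier R" "z \<in> carrier R" using assms comax_carrier rdvd_carrier by auto
  have "(a \<otimes> x \<oplus> \<ominus> (z \<otimes> y)) \<oplus> (b \<oplus> z) \<otimes> y = a \<otimes> x \<oplus> b \<otimes> y"
    using 1(1,2) c by (simp add: ring_simprules)
  then show ?thesis
    using 1 c assms
    by (intro comaxI[where r = "a \<otimes> x \<oplus> \<ominus> (z \<otimes> y)" and s = "(b \<oplus> z) \<otimes> y"])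
      (simp_all add: rdvdI rdvd_add rdvd_uminus rdvd_mult_right)
qed

lemma comax_cong_iff:
  assumes "b \<in> carrier R" "a \<rightharpoonup> z" shows "a \<bowtie> b \<oplus> z \<longleftrightarrow> a \<bowtie> b"
proof
  assume "a \<bowtie> b \<oplus> z"
  from comax_cong[OF this rdvd_uminus[OF assms(2)]]
  show "a \<bowtie> b" using assms rdvd_carrier[OF assms(2)] by (simp add: a_assoc r_neg)
qed (rule comax_cong[OF _ assms(2)])

text \<open>Multiply \<open>x u + y v = 1\<close> by \<open>z\<close> on the right; the duo property
  rewrites \<open>v z\<close> as \<open>z w\<close>, which makes \<open>y z\<close> appear as a
  factor.\<close>

lemma gauss:
  assumes "x \<bowtie> y" "x \<rightharpoonup> y \<otimes> z" "z \<in> carrier R" shows "x \<rightharpoonup> z"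
proof -
  obtain u v where 1: "u \<in> carrier R" "v \<in> carrier R" "x \<otimes> u \<oplus> y \<otimes> v = \<one>"
    using assms(1) by (rule comaxE)
  have c: "x \<in> carrier R" "y \<in> carrier R" using assms comax_carrier by auto
  obtain w where w: "w \<in> carrier R" "v \<otimes> z = z \<otimes> w" using duo_right[of z v] assms(3) 1(2) by blast
  have "z = (x \<otimes> u \<oplus> y \<otimes> v) \<otimes> z" using 1 assms by simp
  also have "\<dots> = x \<otimes> (u \<otimes> z) \<oplus> y \<otimes> z \<otimes> w"
    using 1(1,2) c assms w by (simp add: l_distr m_assoc)
  finally show ?thesis using 1(1,2) c assms w rdvd_add[of x "x \<otimes> (u \<otimes> z)" "y \<otimes> z \<otimes> w"]
    by (simp add: rdvd_mult_right rdvdI)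
qed

text \<open>Here \<open>z\<close> multiplies the Bezout identity on the left: \<open>z x u\<close>
  is a multiple of \<open>x\<close> by the duo property, \<open>z y v\<close> by assumption.\<close>

lemma gauss_right:
  assumes "x \<bowtie> y" "x \<rightharpoonup> z \<otimes> y" "z \<in> carrier R" shows "x \<rightharpoonup> z"
proof -
  obtain u v where 1: "u \<in> carrier R" "v \<in> carrier R" "x \<otimes> u \<oplus> y \<otimes> v = \<one>"
    using assms(1) by (rule comaxE)
  have c: "x \<in> carrier R" "y \<in> carrier R" using assms comax_carrier by auto
  have "z = z \<otimes> (x \<otimes> u \<oplus> y \<otimes> v)" using 1 assms by simp
  also have "\<dots> = z \<otimes> (x \<otimes> u) \<oplus> z \<otimes> y \<otimes> v"
    using 1(1,2) c assms by (simp add: r_distr m_assoc)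
  finally show ?thesis
    using 1(1,2) c assms rdvd_add[of x "z \<otimes> (x \<otimes> u)" "z \<otimes> y \<otimes> v"]
    by (simp add: rdvd_mult_right rdvd_mult_left rdvdI)
qed

lemma left_quotient:
  assumes "d \<rightharpoonup> a" obtains x where "x \<in> carrier R" "a = x \<otimes> d"
  using assms duo_left[of d] by (elim rdvdE) metis

text \<open>Comaximal elements commute up to a unit, since both products generate the intersection of
  the two principal ideals.\<close>

lemma comax_swap:
  assumes "x \<bowtie> y"
  obtains x' where "x' \<in> carrier R" "x \<otimes> y = y \<otimes> x'" "x' \<rightharpoonup> x"
proof (cases "y = \<zero>")
  case True
  then show ?thesis using assms comax_carrier that[of x] by auto
next
  case False
  have c: "x \<in> carrier R" "y \<in> carrier R" using assms comax_carrier by auto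
  obtain x' where x': "x' \<in> carrier R" "x \<otimes> y = y \<otimes> x'" using duo_right[of y x] c by blast
  obtain w where w: "w \<in> carrier R" "y \<otimes> x = x \<otimes> w" using duo_right[of x y] c by blast
  \<comment> \<open>From \<open>y x = x w\<close> and Gauss's lemma, \<open>w = y v\<close>.
    Cancelling \<open>y\<close> in \<open>y x = x y v = y x' v\<close> leaves
    \<open>x = x' v\<close>.\<close>
  have "y \<rightharpoonup> x \<otimes> w" using w c rdvdI[of y x] by simp
  then have "y \<rightharpoonup> w" using gauss[OF comax_sym[OF assms]] w by blast
  then obtain v where v: "v \<in> carrier R" "w = y \<otimes> v" by (auto simp: rdvd_def)
  have "y \<otimes> x = y \<otimes> (x' \<otimes> v)" using w v c x' by (metis m_assoc)
  then have "x = x' \<otimes> v" using False c x' v by (intro cancel_left[of y x "x' \<otimes> v"]) simp_all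
  then show ?thesis using that x' v by (auto simp: rdvd_def)
qed

text \<open>Cancelling \<open>d\<close> from its Bezout identity leaves one for the cofactors;
  excluding \<open>a = b = 0\<close> makes \<open>d\<close> nonzero.\<close>

lemma gcd_factor:
  assumes "a \<in> carrier R" "b \<in> carrier R" "\<not> (a = \<zero> \<and> b = \<zero>)"
  obtains d r s where "d \<noteq> \<zero>" "d \<in> carrier R" "r \<in> carrier R" "s \<in> carrier R"
    "a = d \<otimes> r" "b = d \<otimes> s" "r \<bowtie> s"
    "\<And>e. \<lbrakk>e \<rightharpoonup> a; e \<rightharpoonup> b\<rbrakk> \<Longrightarrow> e \<rightharpoonup> d"
proof -
  obtain d r s x y where *: "d \<in> carrier R" "r \<in> carrier R" "s \<in> carrier R"
    "x \<in> carrier R" "y \<in> carrier R" "a = d \<otimes> r" "b = d \<otimes> s" "a \<otimes> x \<oplus> b \<otimes> y = d"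
    using bezout[OF assms(1,2)] by blast
  have d: "d \<noteq> \<zero>" using * assms by auto
  have "d \<otimes> (r \<otimes> x \<oplus> s \<otimes> y) = d \<otimes> \<one>" using * by (simp add: r_distr m_assoc)
  then have "r \<otimes> x \<oplus> s \<otimes> y = \<one>"
    using d * by (intro cancel_left[of d "r \<otimes> x \<oplus> s \<otimes> y" \<one>]) simp_all
  then have "r \<bowtie> s" using * by (auto simp: comax_def)
  moreover have "e \<rightharpoonup> d" if "e \<rightharpoonup> a" "e \<rightharpoonup> b" for e
    using that * rdvd_add[of e "a \<otimes> x" "b \<otimes> y"] rdvd_mult_right[of e] by simp
  ultimately show ?thesis using that d * by blast
qed

lemma rdvd_cancel_left:
  assumes "d \<otimes> a \<rightharpoonup> d \<otimes> b" "d \<noteq> \<zero>" "d \<in> carrier R" "a \<in> carrier R" "b \<in> carrier R"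
  shows "a \<rightharpoonup> b"
proof -
  obtain x where "x \<in> carrier R" "d \<otimes> b = d \<otimes> a \<otimes> x" using assms(1) by (rule rdvdE)
  then have "b = a \<otimes> x" using cancel_left[of d b "a \<otimes> x"] assms by (simp add: m_assoc)
  then show ?thesis using assms \<open>x \<in> carrier R\<close> by (simp add: rdvdI)
qed

text \<open>Let \<open>d\<close> be a gcd of \<open>b = d r\<close> and \<open>t = d s\<close>.
  Cancelling \<open>d\<close> leaves \<open>r\<close> dividing \<open>s w\<close>, and since
  \<open>r\<close> is comaximal with \<open>s\<close>, it divides \<open>w\<close>.\<close>

lemma rdvd_mult_split:
  assumes "b \<rightharpoonup> t \<otimes> w" "t \<in> carrier R" "w \<in> carrier R"
  obtains t' w' where "t' \<rightharpoonup> t" "w' \<rightharpoonup> w" "b = t' \<otimes> w'"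
proof (cases "b = \<zero> \<and> t = \<zero>")
  case True
  then show ?thesis using that[of \<zero> w] assms by auto
next
  case False
  have c: "b \<in> carrier R" using assms(1) rdvd_carrier by blast
  obtain d r s where *: "d \<noteq> \<zero>" "d \<in> carrier R" "r \<in> carrier R" "s \<in> carrier R"
    "b = d \<otimes> r" "t = d \<otimes> s" "r \<bowtie> s"
    using gcd_factor[OF c assms(2) False] by metis
  have "d \<otimes> r \<rightharpoonup> d \<otimes> (s \<otimes> w)" using assms * by (simp add: m_assoc)
  then have "r \<rightharpoonup> s \<otimes> w" using assms(3) * by (intro rdvd_cancel_left[of d r "s \<otimes> w"]) simp_all
  then have "r \<rightharpoonup> w" using gauss[of r s w] * assms by simp
  then show ?thesis using that[of d r] * by (simp add: rdvdI)
qed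

section \<open>Invertible two by two matrices\<close>

text \<open>A tuple \<open>(p, q, r, s)\<close> stands for the matrix with rows \<open>(p, q)\<close> and \<open>(r, s)\<close>.\<close>

fun inv_pair :: "'a \<times> 'a \<times> 'a \<times> 'a \<Rightarrow> 'a \<times> 'a \<times> 'a \<times> 'a \<Rightarrow> bool" where
  "inv_pair (p, q, r, s) (p', q', r', s') \<longleftrightarrow>
     {p, q, r, s, p', q', r', s'} \<subseteq> carrier R \<and>
     p \<otimes> p' \<oplus> q \<otimes> r' = \<one> \<and> p \<otimes> q' \<oplus> q \<otimes> s' = \<zero> \<and>
     r \<otimes> p' \<oplus> s \<otimes> r' = \<zero> \<and> r \<otimes> q' \<oplus> s \<otimes> s' = \<one> \<and>
     p' \<otimes> p \<oplus> q' \<otimes> r = \<one> \<and> p' \<otimes> q \<oplus> q' \<otimes> s = \<zero> \<and>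
     r' \<otimes> p \<oplus> s' \<otimes> r = \<zero> \<and> r' \<otimes> q \<oplus> s' \<otimes> s = \<one>"

text \<open>The first row \<open>(a, b)\<close> of the inverse consists of left Bezout coefficients.
  The second row \<open>(y, - s)\<close> kills the column because the duo property gives
  \<open>y x = s y\<close>. If one entry is zero, the other is a unit and a diagonal or antidiagonal
  matrix suffices.\<close>

lemma comax_column_completion:
  assumes "x \<bowtie> y"
  obtains p q r s u v where "inv_pair (p, q, r, s) (x, u, y, v)"
proof -
  have c: "x \<in> carrier R" "y \<in> carrier R" using assms comax_carrier by auto
  obtain z w where zw: "z \<in> carrier R" "w \<in> carrier R" "x \<otimes> z \<oplus> y \<otimes> w = \<one>"
    using assms by (rule comaxE)
  obtain a where a: "a \<in> carrier R" "x \<otimes> z = a \<otimes> x" using duo_left[of x z] c zw by blast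
  obtain b where b: "b \<in> carrier R" "y \<otimes> w = b \<otimes> y" using duo_left[of y w] c zw by blast
  have ab: "a \<otimes> x \<oplus> b \<otimes> y = \<one>" using zw a b by simp
  consider "x = \<zero>" | "y = \<zero>" | "x \<noteq> \<zero>" "y \<noteq> \<zero>" by blast
  then show ?thesis
  proof cases
    case 1
    then have "b \<otimes> y = \<one>" "y \<otimes> w = \<one>" using c a b ab zw by auto
    then have "w = b" using b c zw by (metis l_one m_assoc r_one)
    then have "y \<otimes> b = \<one>" using \<open>y \<otimes> w = \<one>\<close> by simp
    then show ?thesis using 1 \<open>b \<otimes> y = \<one>\<close> b c by (intro that[of \<zero> b \<one> \<zero> \<one> \<zero>]) simp
  next
    case 2
    then have "a \<otimes> x = \<one>" "x \<otimes> z = \<one>" using c a b ab zw by auto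
    then have "z = a" using a c zw by (metis l_one m_assoc r_one)
    then have "x \<otimes> a = \<one>" using \<open>x \<otimes> z = \<one>\<close> by simp
    then show ?thesis using 2 \<open>a \<otimes> x = \<one>\<close> a c by (intro that[of a \<zero> \<zero> \<one> \<zero> \<one>]) simp
  next
    case 3
    obtain s where s: "s \<in> carrier R" "y \<otimes> x = s \<otimes> y" using duo_left[of y x] c by blast
    text \<open>The second column \<open>(u, v)\<close> of the inverse comes from dividing \<open>1 - x a\<close> and \<open>- y a\<close>
      by \<open>y\<close> on the right.\<close>
    have ab': "\<one> \<oplus> \<ominus> (b \<otimes> y) = a \<otimes> x" using one_minus[of "b \<otimes> y" "a \<otimes> x"] ab a b c by (simp add: a_comm)
    have "(\<one> \<oplus> \<ominus> (x \<otimes> a)) \<otimes> x = x \<otimes> (\<one> \<oplus> \<ominus> (a \<otimes> x))"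
      using a c by (simp add: ring_simprules)
    also have "\<one> \<oplus> \<ominus> (a \<otimes> x) = b \<otimes> y" using one_minus[of "a \<otimes> x" "b \<otimes> y"] ab a b c by simp
    finally have e1: "(\<one> \<oplus> \<ominus> (x \<otimes> a)) \<otimes> x = x \<otimes> (b \<otimes> y)" .
    have "y \<rightharpoonup> (\<one> \<oplus> \<ominus> (x \<otimes> a)) \<otimes> x" using e1 b c by (simp add: rdvd_mult_left)
    then have "y \<rightharpoonup> \<one> \<oplus> \<ominus> (x \<otimes> a)"
      using gauss_right[OF comax_sym[OF assms]] a c by auto
    then obtain u where u: "u \<in> carrier R" "\<one> \<oplus> \<ominus> (x \<otimes> a) = u \<otimes> y" by (rule left_quotient)
    have "y \<rightharpoonup> \<ominus> (y \<otimes> a)" using a c by (intro rdvd_uminus rdvdI)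
    then obtain v where v: "v \<in> carrier R" "\<ominus> (y \<otimes> a) = v \<otimes> y" by (rule left_quotient)
    have cc: "a \<in> carrier R" "b \<in> carrier R" "s \<in> carrier R" "u \<in> carrier R" "v \<in> carrier R"
      "x \<in> carrier R" "y \<in> carrier R" using a b s u v c by auto
    \<comment> \<open>Identities involving \<open>u\<close> and \<open>v\<close> are checked after
      multiplication by \<open>y\<close> on the right, where \<open>u y\<close> and
      \<open>v y\<close> are known.\<close>
    note cy = cancel_right[OF cc(7) _ _ _ 3(2)]
    have 1: "x \<otimes> a \<oplus> u \<otimes> y = \<one>" using cc by (simp flip: u(2) add: ring_simprules)
    have 2: "y \<otimes> a \<oplus> v \<otimes> y = \<zero>" using cc by (simp flip: v(2) add: ring_simprules)
    have 3: "u \<otimes> s = x \<otimes> b"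
    proof (rule cy)
      show "u \<otimes> s \<otimes> y = x \<otimes> b \<otimes> y"
        using cc e1 by (simp add: m_assoc flip: s(2)) (simp flip: m_assoc u(2))
    qed (use cc in auto)
    have 4: "v \<otimes> s = \<ominus> (\<one> \<oplus> \<ominus> (y \<otimes> b))"
    proof (rule cy)
      have "v \<otimes> s \<otimes> y = \<ominus> (y \<otimes> a) \<otimes> x" using cc by (simp add: m_assoc v(2) flip: s(2))
      also have "\<dots> = \<ominus> (y \<otimes> (a \<otimes> x))" using cc by (simp add: ring_simprules)
      also have "a \<otimes> x = \<one> \<oplus> \<ominus> (b \<otimes> y)" using ab' cc by (simp add: ring_simprules)
      finally show "v \<otimes> s \<otimes> y = \<ominus> (\<one> \<oplus> \<ominus> (y \<otimes> b)) \<otimes> y"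
        using cc by (simp add: ring_simprules)
    qed (use cc in auto)
    have 5: "a \<otimes> u \<oplus> b \<otimes> v = \<zero>"
    proof (rule cy)
      have "(a \<otimes> u \<oplus> b \<otimes> v) \<otimes> y = a \<otimes> (u \<otimes> y) \<oplus> b \<otimes> (v \<otimes> y)"
        using cc by (simp add: l_distr m_assoc)
      also have "\<dots> = a \<oplus> \<ominus> ((a \<otimes> x \<oplus> b \<otimes> y) \<otimes> a)"
        using cc by (simp flip: u(2) v(2) add: ring_simprules)
      finally show "(a \<otimes> u \<oplus> b \<otimes> v) \<otimes> y = \<zero> \<otimes> y" using cc ab by (simp add: r_neg)
    qed (use cc in auto)
    have 6: "y \<otimes> u \<oplus> \<ominus> s \<otimes> v = \<one>"
    proof (rule cy)
      have "(y \<otimes> u \<oplus> \<ominus> s \<otimes> v) \<otimes> y = y \<otimes> (u \<otimes> y) \<oplus> \<ominus> s \<otimes> (v \<otimes> y)"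
        using cc by (simp add: l_distr m_assoc)
      also have "\<dots> = y \<oplus> \<ominus> (y \<otimes> x \<otimes> a) \<oplus> s \<otimes> y \<otimes> a"
        using cc by (simp flip: u(2) v(2) add: ring_simprules)
      finally show "(y \<otimes> u \<oplus> \<ominus> s \<otimes> v) \<otimes> y = \<one> \<otimes> y" using cc s(2) by (simp add: ring_simprules)
    qed (use cc in auto)
    show ?thesis
    proof (rule that[of a b y "\<ominus> s" u v])
      show "inv_pair (a, b, y, \<ominus> s) (x, u, y, v)"
        using cc ab s(2) 1 2 3 4 5 6 by (simp add: ring_simprules)
    qed
  qed
qed

section \<open>Stable range two\<close>

text \<open>The generator \<open>d\<close> of \<open>aR + bR\<close> is itself a common divisor,
  hence right invertible. Comaximality thus becomes a statement about common divisors only.\<close>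

lemma comaxI_common:
  assumes "a \<in> carrier R" "b \<in> carrier R" "\<And>d. \<lbrakk>d \<rightharpoonup> a; d \<rightharpoonup> b\<rbrakk> \<Longrightarrow> d \<rightharpoonup> \<one>"
  shows "a \<bowtie> b"
proof -
  obtain d r s x y where *: "d \<in> carrier R" "r \<in> carrier R" "s \<in> carrier R"
    "x \<in> carrier R" "y \<in> carrier R" "a = d \<otimes> r" "b = d \<otimes> s" "a \<otimes> x \<oplus> b \<otimes> y = d"
    using bezout[OF assms(1,2)] by blast
  have "d \<rightharpoonup> \<one>" by (rule assms(3)) (simp_all add: * rdvdI)
  then obtain z where z: "z \<in> carrier R" "\<one> = d \<otimes> z" by (rule rdvdE)
  have "a \<otimes> (x \<otimes> z) \<oplus> b \<otimes> (y \<otimes> z) = (a \<otimes> x \<oplus> b \<otimes> y) \<otimes> z"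
    using * z(1) by (subst l_distr) (simp_all add: m_assoc)
  also have "\<dots> = \<one>" using * z by simp
  finally show ?thesis using * z assms unfolding comax_def by blast
qed

lemma comax_common: "\<lbrakk>a \<bowtie> b; d \<rightharpoonup> a; d \<rightharpoonup> b\<rbrakk> \<Longrightarrow> d \<rightharpoonup> \<one>"
  by (elim comaxE) (metis rdvd_add rdvd_mult_right)

lemma inv_pair_sym: "inv_pair T S \<Longrightarrow> inv_pair S T"
  by (cases T; cases S) simp

text \<open>Conjugation by \<open>d\<close>, that is \<open>d r = r' d\<close> and likewise for
  \<open>s\<close>, \<open>x\<close>, \<open>y\<close>, transforms the Bezout identity of the left
  cofactors into one for the right cofactors.\<close>

lemma gcd_factor_right:
  assumes "a \<in> carrier R" "b \<in> carrier R" "\<not> (a = \<zero> \<and> b = \<zero>)"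
  obtains d r s where "d \<noteq> \<zero>" "d \<in> carrier R" "r \<in> carrier R" "s \<in> carrier R"
    "a = r \<otimes> d" "b = s \<otimes> d" "r \<bowtie> s"
proof -
  obtain d r s where *: "d \<noteq> \<zero>" "d \<in> carrier R" "r \<in> carrier R" "s \<in> carrier R"
    "a = d \<otimes> r" "b = d \<otimes> s" "r \<bowtie> s"
    using gcd_factor[OF assms] by metis
  obtain x y where xy: "x \<in> carrier R" "y \<in> carrier R" "r \<otimes> x \<oplus> s \<otimes> y = \<one>"
    using *(7) by (rule comaxE)
  obtain r' where r': "r' \<in> carrier R" "d \<otimes> r = r' \<otimes> d" using duo_left[of d r] * by blast
  obtain s' where s': "s' \<in> carrier R" "d \<otimes> s = s' \<otimes> d" using duo_left[of d s] * by blast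
  obtain x' where x': "x' \<in> carrier R" "d \<otimes> x = x' \<otimes> d" using duo_left[of d x] * xy by blast
  obtain y' where y': "y' \<in> carrier R" "d \<otimes> y = y' \<otimes> d" using duo_left[of d y] * xy by blast
  have "(r' \<otimes> x' \<oplus> s' \<otimes> y') \<otimes> d = r' \<otimes> (x' \<otimes> d) \<oplus> s' \<otimes> (y' \<otimes> d)"
    using * r'(1) s'(1) x'(1) y'(1) by (simp add: l_distr m_assoc)
  also have "\<dots> = (r' \<otimes> d) \<otimes> x \<oplus> (s' \<otimes> d) \<otimes> y"
    using *(2) r'(1) s'(1) xy(1,2) by (simp add: m_assoc flip: x'(2) y'(2))
  also have "\<dots> = d \<otimes> (r \<otimes> x \<oplus> s \<otimes> y)"
    using *(2-4) xy(1,2) by (simp add: r_distr m_assoc flip: r'(2) s'(2))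
  finally have "(r' \<otimes> x' \<oplus> s' \<otimes> y') \<otimes> d = \<one> \<otimes> d" using xy * by simp
  then have "r' \<otimes> x' \<oplus> s' \<otimes> y' = \<one>"
    using * r'(1) s'(1) x'(1) y'(1) by (intro cancel_right[of d _ \<one>]) simp_all
  then have "r' \<bowtie> s'" using r' s' x' y' unfolding comax_def by blast
  then show ?thesis using that[of d r' s'] * r' s' by simp
qed

text \<open>Divide the column by a common right factor \<open>d\<close>, complete the comaximal
  column that is left to an invertible matrix, and use the inverse: its second row annihilates the
  column.\<close>

lemma hermite_column:
  assumes "x \<in> carrier R" "y \<in> carrier R"
  obtains p q r s S where "inv_pair (p, q, r, s) S" "r \<otimes> x \<oplus> s \<otimes> y = \<zero>"
proof (cases "x = \<zero> \<and> y = \<zero>")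
  case True
  then show ?thesis by (intro that[of \<one> \<zero> \<zero> \<one> "(\<one>, \<zero>, \<zero>, \<one>)"]) simp_all
next
  case False
  obtain d x' y' where *: "d \<in> carrier R" "x' \<in> carrier R" "y' \<in> carrier R"
    "x = x' \<otimes> d" "y = y' \<otimes> d" "x' \<bowtie> y'"
    using gcd_factor_right[OF assms False] by metis
  obtain p q r s u v where T: "inv_pair (p, q, r, s) (x', u, y', v)"
    using comax_column_completion[OF *(6)] by blast
  then have "r \<otimes> x \<oplus> s \<otimes> y = (r \<otimes> x' \<oplus> s \<otimes> y') \<otimes> d"
    using * by (subst l_distr) (simp_all add: m_assoc)
  then have "r \<otimes> x \<oplus> s \<otimes> y = \<zero>" using T * by simp
  then show ?thesis using that[OF T] by blast
qed

text \<open>The column \<open>(e, t)\<close> is \<open>h\<close> times the first column of an invertible matrix; adding \<open>k\<close>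
  times the second column turns it into the image of the unimodular column \<open>(h, k)\<close>.\<close>

lemma stable_range_two:
  assumes c: "e \<in> carrier R" "t \<in> carrier R" "k \<in> carrier R"
    and h: "\<And>d. \<lbrakk>d \<rightharpoonup> e; d \<rightharpoonup> t; d \<rightharpoonup> k\<rbrakk> \<Longrightarrow> d \<rightharpoonup> \<one>"
  obtains x y where "x \<in> carrier R" "y \<in> carrier R" "e \<oplus> k \<otimes> x \<bowtie> t \<oplus> k \<otimes> y"
proof (cases "e = \<zero> \<and> t = \<zero>")
  case True
  then have "k \<rightharpoonup> \<one>" using h[of k] c by simp
  then obtain z where "z \<in> carrier R" "\<one> = k \<otimes> z" by (rule rdvdE)
  then show ?thesis using True c comax_sym[OF comax_one[of \<zero>]]
    by (intro that[of z \<zero>]) simp_all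
next
  case False
  obtain d x' y' where *: "d \<in> carrier R" "x' \<in> carrier R" "y' \<in> carrier R"
    "e = x' \<otimes> d" "t = y' \<otimes> d" "x' \<bowtie> y'"
    using gcd_factor_right[OF c(1,2) False] by metis
  obtain p q r s u v where T: "inv_pair (p, q, r, s) (x', u, y', v)"
    using comax_column_completion[OF *(6)] by blast
  obtain x where x: "x \<in> carrier R" "u \<otimes> k = k \<otimes> x" using duo_right[of k u] T c by auto
  obtain y where y: "y \<in> carrier R" "v \<otimes> k = k \<otimes> y" using duo_right[of k v] T c by auto
  let ?e = "x' \<otimes> d \<oplus> u \<otimes> k" and ?t = "y' \<otimes> d \<oplus> v \<otimes> k"
  have T': "{p, q, r, s, x', u, y', v} \<subseteq> carrier R" using T by simp
  have "p \<otimes> ?e \<oplus> q \<otimes> ?t = (p \<otimes> x' \<oplus> q \<otimes> y') \<otimes> d \<oplus> (p \<otimes> u \<oplus> q \<otimes> v) \<otimes> k"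
    using T' * c by (simp add: l_distr r_distr m_assoc a_ac)
  then have d: "d = p \<otimes> ?e \<oplus> q \<otimes> ?t" using T * c by simp
  have "r \<otimes> ?e \<oplus> s \<otimes> ?t = (r \<otimes> x' \<oplus> s \<otimes> y') \<otimes> d \<oplus> (r \<otimes> u \<oplus> s \<otimes> v) \<otimes> k"
    using T' * c by (simp add: l_distr r_distr m_assoc a_ac)
  then have k: "k = r \<otimes> ?e \<oplus> s \<otimes> ?t" using T * c by simp
  \<comment> \<open>\<open>d\<close> and \<open>k\<close> are left combinations of \<open>?e\<close>
    and \<open>?t\<close>, so a common divisor of the latter divides \<open>e = x' d\<close>,
    \<open>t = y' d\<close> and \<open>k\<close>.\<close>
  have "?e \<bowtie> ?t"
  proof (rule comaxI_common)
    fix z assume z: "z \<rightharpoonup> ?e" "z \<rightharpoonup> ?t"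
    have "z \<rightharpoonup> d" "z \<rightharpoonup> k"
      using z T' by (subst d, simp add: rdvd_add rdvd_mult_left, subst k, simp add: rdvd_add rdvd_mult_left)
    then show "z \<rightharpoonup> \<one>" using h[of z] * by (simp add: rdvd_mult_left)
  qed (use T' * c in auto)
  then show ?thesis using that x y * by simp
qed

section \<open>Factorisations modulo a PM element\<close>

text \<open>The monoid of finite products in which each factor is comaximal with \<open>a\<close> or
  with \<open>g\<close>. The kinds may alternate; sorting them is a separate step.\<close>

inductive_set comax_products :: "'a \<Rightarrow> 'a \<Rightarrow> 'a set" for a g where
  one: "\<one> \<in> comax_products a g"
| mult: "\<lbrakk>t \<bowtie> a \<or> t \<bowtie> g; w \<in> comax_products a g\<rbrakk> \<Longrightarrow> t \<otimes> w \<in> comax_products a g"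

lemma comax_products_carrier: "w \<in> comax_products a g \<Longrightarrow> w \<in> carrier R"
  by (induction rule: comax_products.induct) (auto dest: comax_carrier)

lemma comax_products_mult:
  "\<lbrakk>v \<in> comax_products a g; w \<in> comax_products a g\<rbrakk> \<Longrightarrow> v \<otimes> w \<in> comax_products a g"
proof (induction v rule: comax_products.induct)
  case one
  then show ?case using comax_products_carrier by simp
next
  case (mult t v)
  then show ?case using comax_products.mult[of t a g "v \<otimes> w"] comax_products_carrier comax_carrier
    by (metis m_assoc)
qed

text \<open>A divisor of \<open>t w\<close> splits into a divisor of \<open>t\<close>, which
  inherits comaximality from \<open>t\<close>, and a divisor of \<open>w\<close>. A divisor of 1 is
  comaximal with everything and counts as a single factor.\<close>

lemma comax_products_rdvd:
  assumes "w \<in> comax_products a g" "b \<rightharpoonup> w" "a \<in> carrier R" shows "b \<in> comax_products a g"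
  using assms(1,2)
proof (induction w arbitrary: b rule: comax_products.induct)
  case one
  have "b \<bowtie> a" using comax_rdvd[OF comax_one one] assms(3) comax_sym by blast
  then show ?case
    using comax_products.mult[of b a g \<one>] comax_products.one rdvd_carrier[OF one] by simp
next
  case (mult t w)
  have "t \<in> carrier R" using mult.hyps comax_carrier by auto
  then obtain t' w' where *: "t' \<rightharpoonup> t" "w' \<rightharpoonup> w" "b = t' \<otimes> w'"
    using rdvd_mult_split[OF mult.prems] comax_products_carrier mult.hyps by metis
  have "t' \<bowtie> a \<or> t' \<bowtie> g" using mult.hyps(1) comax_rdvd[OF _ *(1)] comax_sym by blast
  then show ?case using mult.IH[OF *(2)] * comax_products.mult by simp
qed

text \<open>The ideal is \<open>P + xR\<close>; the explicit shape of its elements turns maximality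
  of \<open>P\<close> into equations.\<close>

lemma ideal_adjoin:
  assumes "ideal P R" "x \<in> carrier R"
  obtains J where "ideal J R" "P \<subseteq> J" "x \<in> J" "\<And>z. z \<in> J \<Longrightarrow> \<exists>p\<in>P. \<exists>r\<in>carrier R. z = p \<oplus> x \<otimes> r"
proof
  interpret P: ideal P R by fact
  interpret X: ideal "{a. x \<rightharpoonup> a}" R using rdvd_ideal assms(2) .
  let ?J = "P <+>\<^bsub>R\<^esub> {a. x \<rightharpoonup> a}"
  show "ideal ?J R" using add_ideals P.is_ideal X.is_ideal .
  have J: "p \<oplus> q \<in> ?J" if "p \<in> P" "x \<rightharpoonup> q" for p q
    using that by (auto simp: set_add_defs)
  show "P \<subseteq> ?J"
  proof
    fix p assume "p \<in> P"
    then show "p \<in> ?J" using J[of p \<zero>] P.Icarr assms(2) by simp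
  qed
  show "x \<in> ?J" using J[of \<zero> x] P.zero_closed assms(2) by simp
  show "\<exists>p\<in>P. \<exists>r\<in>carrier R. z = p \<oplus> x \<otimes> r" if "z \<in> ?J" for z
    using that unfolding set_add_def' rdvd_def by blast
qed

text \<open>Otherwise an ideal maximal among those containing \<open>b\<close> and disjoint from the monoid of these
  products is a completely prime ideal that is contained in a maximal ideal containing \<open>a\<close> and in
  another one containing \<open>g\<close>.\<close>

lemma PM_divides_comax_product:
  assumes PM: "PM_element R b" and ag: "a \<bowtie> g"
  obtains w where "w \<in> comax_products a g" "b \<rightharpoonup> w"
proof (rule ccontr)
  let ?S = "comax_products a g"
  have b: "b \<in> carrier R" using PM by (simp add: PM_element_def)
  have c: "a \<in> carrier R" "g \<in> carrier R" using ag comax_carrier by auto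
  have I: "ideal {x. b \<rightharpoonup> x} R" using rdvd_ideal b .
  have "b <# carrier R = {x. b \<rightharpoonup> x}" using b by (auto simp: l_coset_def rdvd_def)
  then have PMQ: "PM_ring (R Quot {x. b \<rightharpoonup> x})" using PM by (simp add: PM_element_def)
  assume "\<not> thesis"
  then have "{x. b \<rightharpoonup> x} \<inter> ?S = {}" using that by blast
  then obtain P where P: "ideal P R" "{x. b \<rightharpoonup> x} \<subseteq> P" "P \<inter> ?S = {}"
    "\<And>J. \<lbrakk>ideal J R; P \<subseteq> J; J \<inter> ?S = {}\<rbrakk> \<Longrightarrow> J = P"
    using ideal_maximal_disjoint[OF I] by metis
  interpret P: ideal P R by fact
  have one: "\<one> \<notin> P" using P(3) comax_products.one by blast
  \<comment> \<open>The ideal \<open>P + xR\<close> is strictly larger than \<open>P\<close>, so by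
    maximality it meets the monoid.\<close>
  have meets: "\<exists>p\<in>P. \<exists>r\<in>carrier R. p \<oplus> x \<otimes> r \<in> ?S" if x: "x \<in> carrier R" "x \<notin> P" for x
  proof -
    obtain J where J: "ideal J R" "P \<subseteq> J" "x \<in> J"
      "\<And>z. z \<in> J \<Longrightarrow> \<exists>p\<in>P. \<exists>r\<in>carrier R. z = p \<oplus> x \<otimes> r"
      using ideal_adjoin[OF P(1) x(1)] by metis
    then have "J \<inter> ?S \<noteq> {}" using P(4) x by blast
    then show ?thesis using J(4) by blast
  qed
  \<comment> \<open>If \<open>x\<close> and \<open>y\<close> lie outside \<open>P\<close>, the
    monoid contains some \<open>p + x r\<close> and \<open>q + y s\<close>, hence their product.
    Moving \<open>r\<close> past \<open>y\<close> shows that this product is in \<open>P\<close> as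
    soon as \<open>x y\<close> is.\<close>
  have prime: "x \<in> P \<or> y \<in> P" if xy: "x \<in> carrier R" "y \<in> carrier R" "x \<otimes> y \<in> P" for x y
  proof (rule ccontr)
    assume "\<not> (x \<in> P \<or> y \<in> P)"
    then obtain p r q s where *: "p \<in> P" "r \<in> carrier R" "p \<oplus> x \<otimes> r \<in> ?S"
      "q \<in> P" "s \<in> carrier R" "q \<oplus> y \<otimes> s \<in> ?S"
      using meets xy by metis
    have pq: "p \<in> carrier R" "q \<in> carrier R" using * P.Icarr by auto
    obtain r' where r': "r' \<in> carrier R" "r \<otimes> y = y \<otimes> r'" using duo_right[of y r] xy * by blast
    have "(p \<oplus> x \<otimes> r) \<otimes> (q \<oplus> y \<otimes> s) = p \<otimes> (q \<oplus> y \<otimes> s) \<oplus> (x \<otimes> r \<otimes> q \<oplus> x \<otimes> (r \<otimes> y) \<otimes> s)"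
      using * pq xy by (simp add: l_distr r_distr m_assoc a_ac)
    also have "x \<otimes> (r \<otimes> y) \<otimes> s = x \<otimes> y \<otimes> (r' \<otimes> s)" using r' * xy by (simp add: m_assoc)
    also have "p \<otimes> (q \<oplus> y \<otimes> s) \<oplus> (x \<otimes> r \<otimes> q \<oplus> x \<otimes> y \<otimes> (r' \<otimes> s)) \<in> P"
      using * xy r' pq by (intro P.a_closed P.I_r_closed[of p] P.I_l_closed[of q] P.I_r_closed[of "x \<otimes> y"]) simp_all
    finally show False using comax_products_mult[OF *(3,6)] P(3) by blast
  qed
  \<comment> \<open>If 1 were in \<open>P + xR\<close>, some \<open>p\<close> in \<open>P\<close>
    would be comaximal with \<open>x\<close> and so be a one-factor product in
    \<open>?S\<close>.\<close>
  have above: "\<exists>M. maximalideal M R \<and> P \<subseteq> M \<and> x \<in> M" if x: "x = a \<or> x = g" for x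
  proof -
    have xc: "x \<in> carrier R" using x c by auto
    obtain J where J: "ideal J R" "P \<subseteq> J" "x \<in> J"
      "\<And>z. z \<in> J \<Longrightarrow> \<exists>p\<in>P. \<exists>r\<in>carrier R. z = p \<oplus> x \<otimes> r"
      using ideal_adjoin[OF P(1) xc] by metis
    have "\<one> \<notin> J"
    proof
      assume "\<one> \<in> J"
      then obtain p r where "p \<in> P" "r \<in> carrier R" "\<one> = p \<oplus> x \<otimes> r" using J(4) by blast
      then have "p \<bowtie> x" using P.Icarr xc by (intro comaxI[where r = p and s = "x \<otimes> r"]) (simp_all add: rdvdI)
      then have "p \<otimes> \<one> \<in> ?S" using x comax_products.mult[OF _ comax_products.one, of p a g] by blast
      then show False using \<open>p \<in> P\<close> P.Icarr P(3) by auto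
    qed
    then show ?thesis using maximalideal_exists[OF J(1)] J(2,3) by (metis subset_iff)
  qed
  obtain M where M: "maximalideal M R" "P \<subseteq> M" "a \<in> M" using above by blast
  obtain N where N: "maximalideal N R" "P \<subseteq> N" "g \<in> N" using above by blast
  have "M = N"
    using one quotient_PM_unique_maximal[OF I PMQ P(1,2) _ prime M(1,2) N(1,2)] by blast
  interpret M: maximalideal M R by fact
  obtain x y where "x \<in> carrier R" "y \<in> carrier R" "a \<otimes> x \<oplus> g \<otimes> y = \<one>" using ag by (rule comaxE)
  then have "\<one> \<in> M" using M.I_r_closed M.a_closed M(3) N(3) \<open>M = N\<close> by metis
  then show False using M.one_imp_carrier M.I_notcarr by blast
qed

section \<open>Reduction of triangular two by two matrices\<close>

lemma rdvd_addD:
  assumes "d \<rightharpoonup> x" "d \<rightharpoonup> x \<oplus> y" "y \<in> carrier R" shows "d \<rightharpoonup> y"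
proof -
  have "x \<in> carrier R" using assms rdvd_carrier by blast
  then have "y = \<ominus> x \<oplus> (x \<oplus> y)" using assms by (simp add: r_neg1)
  then show ?thesis using rdvd_add[OF rdvd_uminus[OF assms(1)] assms(2)] by simp
qed

text \<open>Shifting by multiples of \<open>a g c\<close> preserves all four comaximality relations.
  Stable range two applies because a common divisor of \<open>e\<close> and \<open>t\<close> is
  comaximal with \<open>a\<close>, \<open>c\<close> and \<open>g\<close>, so it can divide their
  product only if it divides 1.\<close>

lemma comaximal_representatives:
  assumes "e \<bowtie> a" "e \<bowtie> c" "t \<bowtie> g" "t \<bowtie> c"
  obtains y z where "c \<rightharpoonup> y" "c \<rightharpoonup> z" "e \<oplus> y \<bowtie> t \<oplus> z"
    "e \<oplus> y \<bowtie> a" "e \<oplus> y \<bowtie> c" "t \<oplus> z \<bowtie> g" "t \<oplus> z \<bowtie> c"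
proof -
  have carr: "e \<in> carrier R" "t \<in> carrier R" "a \<in> carrier R" "c \<in> carrier R" "g \<in> carrier R"
    using assms comax_carrier by auto
  let ?k = "a \<otimes> g \<otimes> c"
  have "d \<rightharpoonup> \<one>" if d: "d \<rightharpoonup> e" "d \<rightharpoonup> t" "d \<rightharpoonup> ?k" for d
  proof -
    have "d \<bowtie> a" "d \<bowtie> c" "d \<bowtie> g"
      using comax_rdvd[OF comax_sym[OF assms(1)] d(1)] comax_rdvd[OF comax_sym[OF assms(2)] d(1)]
        comax_rdvd[OF comax_sym[OF assms(3)] d(2)] by (simp_all add: comax_sym)
    then have "d \<bowtie> ?k" by (simp add: comax_mult)
    then show ?thesis using comax_common[of d ?k d] d rdvd_carrier by simp
  qed
  then obtain y z where yz: "y \<in> carrier R" "z \<in> carrier R" "e \<oplus> ?k \<otimes> y \<bowtie> t \<oplus> ?k \<otimes> z"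
    using stable_range_two[of e t ?k] carr by auto
  have k: "a \<rightharpoonup> ?k" "g \<rightharpoonup> ?k" "c \<rightharpoonup> ?k"
    using carr by (simp_all add: m_assoc rdvdI rdvd_mult_left)
  show ?thesis
  proof (rule that[OF _ _ yz(3)])
    show "c \<rightharpoonup> ?k \<otimes> y" "c \<rightharpoonup> ?k \<otimes> z" using k yz by (simp_all add: rdvd_mult_right)
    show "e \<oplus> ?k \<otimes> y \<bowtie> a" "e \<oplus> ?k \<otimes> y \<bowtie> c" "t \<oplus> ?k \<otimes> z \<bowtie> g" "t \<oplus> ?k \<otimes> z \<bowtie> c"
      using comax_cong[OF comax_sym[OF assms(1)] rdvd_mult_right[OF k(1) yz(1)]]
        comax_cong[OF comax_sym[OF assms(2)] rdvd_mult_right[OF k(3) yz(1)]]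
        comax_cong[OF comax_sym[OF assms(3)] rdvd_mult_right[OF k(2) yz(2)]]
        comax_cong[OF comax_sym[OF assms(4)] rdvd_mult_right[OF k(3) yz(2)]]
      by (simp_all add: comax_sym)
  qed
qed

text \<open>Conjugation can move maximal ideals, so a factor \<open>t\<close> comaximal with \<open>g\<close> cannot simply be
  moved past a factor \<open>e\<close> comaximal with \<open>a\<close>.  Modulo \<open>c\<close> this is possible: stable range two
  allows replacing \<open>t\<close> and \<open>e\<close> by comaximal representatives, and these commute up to a unit.\<close>

lemma comax_products_sorted:
  assumes "w \<in> comax_products a g" "w \<bowtie> c" "a \<in> carrier R" "g \<in> carrier R"
  shows "\<exists>e v z. e \<bowtie> a \<and> e \<bowtie> c \<and> v \<bowtie> g \<and> v \<bowtie> c \<and> c \<rightharpoonup> z \<and> w = e \<otimes> v \<oplus> z"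
  using assms(1,2)
proof (induction w rule: comax_products.induct)
  case one
  have "c \<in> carrier R" using one comax_carrier by blast
  then show ?case using assms(3,4) comax_sym[OF comax_one]
    by (intro exI[of _ \<one>] exI[of _ \<zero>]) simp
next
  case (mult t w)
  have tw: "t \<in> carrier R" "w \<in> carrier R" "c \<in> carrier R"
    using mult.hyps mult.prems comax_carrier comax_products_carrier by auto
  have tc: "t \<bowtie> c" and wc: "w \<bowtie> c"
    using comax_multD[OF comax_sym[OF mult.prems] tw(1,2)] comax_sym by auto
  obtain e v z where *: "e \<bowtie> a" "e \<bowtie> c" "v \<bowtie> g" "v \<bowtie> c" "c \<rightharpoonup> z" "w = e \<otimes> v \<oplus> z"
    using mult.IH[OF wc] by blast
  have evz: "e \<in> carrier R" "v \<in> carrier R" "z \<in> carrier R"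
    using * comax_carrier rdvd_carrier by auto
  from mult.hyps(1) show ?case
  proof
    \<comment> \<open>A factor comaximal with \<open>a\<close> is simply absorbed into
      \<open>e\<close>.\<close>
    assume ta: "t \<bowtie> a"
    have "t \<otimes> w = t \<otimes> e \<otimes> v \<oplus> t \<otimes> z" using * evz tw by (simp add: r_distr m_assoc)
    moreover have "t \<otimes> e \<bowtie> a" "t \<otimes> e \<bowtie> c"
      using comax_mult[OF comax_sym[OF ta] comax_sym[OF *(1)]]
        comax_mult[OF comax_sym[OF tc] comax_sym[OF *(2)]] comax_sym by auto
    moreover have "c \<rightharpoonup> t \<otimes> z" using * tw by (simp add: rdvd_mult_left)
    ultimately show ?case using * by blast
  next
    assume tg: "t \<bowtie> g"
    obtain y x where yx: "c \<rightharpoonup> y" "c \<rightharpoonup> x" "e \<oplus> y \<bowtie> t \<oplus> x"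
      "e \<oplus> y \<bowtie> a" "e \<oplus> y \<bowtie> c" "t \<oplus> x \<bowtie> g" "t \<oplus> x \<bowtie> c"
      using comaximal_representatives[OF *(1,2) tg tc] by metis
    have yx': "y \<in> carrier R" "x \<in> carrier R" using yx rdvd_carrier by auto
    obtain s where s: "s \<in> carrier R" "(t \<oplus> x) \<otimes> (e \<oplus> y) = (e \<oplus> y) \<otimes> s" "s \<rightharpoonup> t \<oplus> x"
      using comax_swap[OF comax_sym[OF yx(3)]] by metis
    have sg: "s \<bowtie> g" and sc: "s \<bowtie> c"
      using comax_rdvd[OF comax_sym[OF yx(6)] s(3)] comax_rdvd[OF comax_sym[OF yx(7)] s(3)] comax_sym
      by auto
    \<comment> \<open>The error made in replacing \<open>t e\<close> by
      \<open>(t + x) (e + y)\<close>, a multiple of \<open>c\<close>.\<close>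
    let ?r = "t \<otimes> y \<oplus> (x \<otimes> e \<oplus> x \<otimes> y)"
    have r: "?r \<in> carrier R" using tw evz yx' by simp
    have "(e \<oplus> y) \<otimes> (s \<otimes> v) = (t \<oplus> x) \<otimes> (e \<oplus> y) \<otimes> v"
      using s(1) evz yx' by (simp add: m_assoc s(2))
    also have "(t \<oplus> x) \<otimes> (e \<oplus> y) = t \<otimes> e \<oplus> ?r"
      using tw evz yx' by (simp add: l_distr r_distr a_ac)
    also have "(t \<otimes> e \<oplus> ?r) \<otimes> v = t \<otimes> e \<otimes> v \<oplus> ?r \<otimes> v" using tw evz r by (simp add: l_distr)
    finally have "(e \<oplus> y) \<otimes> (s \<otimes> v) \<oplus> (\<ominus> (?r \<otimes> v) \<oplus> t \<otimes> z) = t \<otimes> e \<otimes> v \<oplus> t \<otimes> z"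
      using tw evz r by (simp add: a_assoc r_neg2)
    then have "t \<otimes> w = (e \<oplus> y) \<otimes> (s \<otimes> v) \<oplus> (\<ominus> (?r \<otimes> v) \<oplus> t \<otimes> z)"
      using * evz tw by (simp add: r_distr m_assoc)
    moreover have "c \<rightharpoonup> \<ominus> (?r \<otimes> v) \<oplus> t \<otimes> z"
      using yx(1,2) yx' *(5) tw evz by (simp add: rdvd_mult_left rdvd_mult_right rdvd_add rdvd_uminus)
    moreover have "s \<otimes> v \<bowtie> g" "s \<otimes> v \<bowtie> c"
      using comax_mult[OF comax_sym[OF sg] comax_sym[OF *(3)]]
        comax_mult[OF comax_sym[OF sc] comax_sym[OF *(4)]] comax_sym by auto
    ultimately show ?case using yx(4,5) by blast
  qed
qed

text \<open>After division by \<open>g\<close>, the sum \<open>b1 u + c1 q\<close> can be any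
  element of the class of \<open>b1 u\<close> modulo \<open>c1\<close>. With \<open>u\<close>
  inverse to \<open>v\<close> that class is the class of \<open>e\<close>, and a representative
  comaximal with both \<open>a\<close> and \<open>u\<close> exists.\<close>

lemma PM_triangular:
  assumes PM: "PM_element R b" and carr: "a \<in> carrier R" "c \<in> carrier R"
    and gcd: "\<And>d. \<lbrakk>d \<rightharpoonup> a; d \<rightharpoonup> b; d \<rightharpoonup> c\<rbrakk> \<Longrightarrow> d \<rightharpoonup> \<one>"
  obtains u q where "u \<in> carrier R" "q \<in> carrier R" "a \<otimes> u \<bowtie> b \<otimes> u \<oplus> c \<otimes> q"
proof (cases "b = \<zero> \<and> c = \<zero>")
  case True
  then have "a \<rightharpoonup> \<one>" using gcd[of a] carr by simp
  then obtain z where "z \<in> carrier R" "\<one> = a \<otimes> z" by (rule rdvdE)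
  then show ?thesis using True comax_sym[OF comax_one[of \<zero>]] by (intro that[of z \<zero>]) simp_all
next
  case False
  have b: "b \<in> carrier R" using PM by (simp add: PM_element_def)
  obtain g b1 c1 where g: "g \<in> carrier R" "b1 \<in> carrier R" "c1 \<in> carrier R"
    "b = g \<otimes> b1" "c = g \<otimes> c1" "b1 \<bowtie> c1"
    using gcd_factor[OF b carr(2) False] by metis
  have ag: "a \<bowtie> g"
    by (rule comaxI_common) (use g carr in \<open>auto intro!: gcd simp: rdvd_mult_right\<close>)
  obtain w where w: "w \<in> comax_products a g" "b \<rightharpoonup> w"
    using PM_divides_comax_product[OF PM ag] .
  have "b1 \<rightharpoonup> b" using g by (simp add: rdvd_mult_left)
  then have "b1 \<in> comax_products a g"
    using comax_products_rdvd[OF w(1) rdvd_trans[OF _ w(2)] carr(1)] by blast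
  then obtain e v z where *: "e \<bowtie> a" "e \<bowtie> c1" "v \<bowtie> g" "v \<bowtie> c1" "c1 \<rightharpoonup> z" "b1 = e \<otimes> v \<oplus> z"
    using comax_products_sorted[OF _ g(6) carr(1) g(1)] by blast
  have evz: "e \<in> carrier R" "v \<in> carrier R" "z \<in> carrier R"
    using * comax_carrier rdvd_carrier by auto
  \<comment> \<open>Inverting \<open>v\<close> modulo \<open>g c1\<close>, not just modulo
    \<open>c1\<close>, makes \<open>k\<close> comaximal with \<open>g\<close> as well.\<close>
  obtain k l where kl: "k \<in> carrier R" "l \<in> carrier R" "v \<otimes> k \<oplus> g \<otimes> c1 \<otimes> l = \<one>"
    using comax_mult[OF *(3,4)] by (rule comaxE)
  have kx: "k \<bowtie> x" if x: "x \<in> carrier R" "x \<rightharpoonup> g \<otimes> c1 \<otimes> l" for x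
  proof (rule comaxI_common)
    fix d assume d: "d \<rightharpoonup> k" "d \<rightharpoonup> x"
    then have "d \<rightharpoonup> v \<otimes> k \<oplus> g \<otimes> c1 \<otimes> l" using evz rdvd_trans[OF d(2) x(2)]
      by (simp add: rdvd_add rdvd_mult_left)
    then show "d \<rightharpoonup> \<one>" using kl by simp
  qed (use kl x in auto)
  have kg: "k \<bowtie> g" "k \<bowtie> c1"
    by (rule kx; use g kl in \<open>simp add: m_assoc rdvdI rdvd_mult_left\<close>)+
  obtain y x where yx: "c1 \<rightharpoonup> y" "c1 \<rightharpoonup> x" "e \<oplus> y \<bowtie> k \<oplus> x"
    "e \<oplus> y \<bowtie> a" "e \<oplus> y \<bowtie> c1" "k \<oplus> x \<bowtie> g" "k \<oplus> x \<bowtie> c1"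
    using comaximal_representatives[OF *(1,2) kg] by metis
  have yx': "y \<in> carrier R" "x \<in> carrier R" using yx rdvd_carrier by auto
  let ?s = "\<ominus> (g \<otimes> c1 \<otimes> l)"
  have vk: "v \<otimes> k = \<one> \<oplus> ?s"
    using one_minus[of "g \<otimes> c1 \<otimes> l" "v \<otimes> k"] kl evz g by (simp add: a_comm)
  \<comment> \<open>Modulo \<open>c1\<close>, \<open>z\<close> and \<open>x\<close> vanish and
    \<open>v k\<close> is 1, so only \<open>e\<close> survives; the rest is collected in
    \<open>?r\<close>.\<close>
  have "b1 \<otimes> (k \<oplus> x) = e \<otimes> (v \<otimes> k) \<oplus> (e \<otimes> v \<otimes> x \<oplus> (z \<otimes> k \<oplus> z \<otimes> x))"
    using *(6) evz kl(1) yx' by (simp add: l_distr r_distr m_assoc a_ac)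
  also have "\<dots> = e \<oplus> (e \<otimes> ?s \<oplus> (e \<otimes> v \<otimes> x \<oplus> (z \<otimes> k \<oplus> z \<otimes> x)))" (is "_ = e \<oplus> ?r")
    unfolding vk using evz kl g yx' by (simp add: r_distr a_assoc)
  finally have b1k: "b1 \<otimes> (k \<oplus> x) = e \<oplus> ?r" .
  have "c1 \<rightharpoonup> g \<otimes> c1 \<otimes> l" using g kl by (simp add: rdvd_mult_left rdvd_mult_right)
  then have r: "c1 \<rightharpoonup> ?r"
    using yx * evz kl g by (intro rdvd_add) (simp_all add: rdvd_mult_left rdvd_mult_right rdvd_uminus)
  then have "c1 \<rightharpoonup> \<ominus> ?r \<oplus> y" by (rule rdvd_add[OF rdvd_uminus yx(1)])
  \<comment> \<open>\<open>q\<close> is chosen so that \<open>c1 q\<close> trades the remainder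
    \<open>?r\<close> for \<open>y\<close>, giving the prepared representative
    \<open>e + y\<close>.\<close>
  then obtain q where q: "q \<in> carrier R" "\<ominus> ?r \<oplus> y = c1 \<otimes> q" by (rule rdvdE)
  have "b1 \<otimes> (k \<oplus> x) \<oplus> c1 \<otimes> q = e \<oplus> y"
    unfolding b1k q(2)[symmetric] using evz yx' conjunct2[OF rdvd_carrier[OF r]]
    by (metis a_assoc a_inv_closed a_closed r_neg2)
  then have "g \<otimes> (b1 \<otimes> (k \<oplus> x) \<oplus> c1 \<otimes> q) = g \<otimes> (e \<oplus> y)" by simp
  then have eq: "b \<otimes> (k \<oplus> x) \<oplus> c \<otimes> q = g \<otimes> (e \<oplus> y)"
    using g kl yx' q(1) by (simp add: r_distr m_assoc)
  have "a \<bowtie> g \<otimes> (e \<oplus> y)" "k \<oplus> x \<bowtie> g \<otimes> (e \<oplus> y)"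
    using ag yx by (simp_all add: comax_mult comax_sym)
  then have "a \<otimes> (k \<oplus> x) \<bowtie> g \<otimes> (e \<oplus> y)"
    using comax_mult[of "g \<otimes> (e \<oplus> y)" a "k \<oplus> x"] comax_sym by blast
  then show ?thesis using that[of "k \<oplus> x" q] eq q kl yx' by simp
qed

text \<open>Adding multiples of \<open>a\<close> and \<open>c\<close> to \<open>b\<close> does not affect the conclusion, which makes it
  possible to replace \<open>b\<close> by a PM element.\<close>

lemma gelfand_triangular:
  assumes G: "gelfand_range_1 R" and carr: "a \<in> carrier R" "b \<in> carrier R" "c \<in> carrier R"
    and gcd: "\<And>d. \<lbrakk>d \<rightharpoonup> a; d \<rightharpoonup> b; d \<rightharpoonup> c\<rbrakk> \<Longrightarrow> d \<rightharpoonup> \<one>"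
  obtains u q where "u \<in> carrier R" "q \<in> carrier R" "a \<otimes> u \<bowtie> b \<otimes> u \<oplus> c \<otimes> q"
proof -
  \<comment> \<open>\<open>h\<close> generates \<open>aR + cR\<close>, so \<open>b\<close> is
    comaximal with it, and Gelfand range 1 yields a PM element \<open>b + h t\<close>.\<close>
  obtain h r s x y where h: "h \<in> carrier R" "r \<in> carrier R" "s \<in> carrier R" "x \<in> carrier R"
    "y \<in> carrier R" "a = h \<otimes> r" "c = h \<otimes> s" "a \<otimes> x \<oplus> c \<otimes> y = h"
    using bezout[OF carr(1,3)] by blast
  have "b \<bowtie> h"
    by (rule comaxI_common) (use h carr in \<open>auto intro!: gcd simp: rdvd_mult_right\<close>)
  then obtain m n where mn: "m \<in> carrier R" "n \<in> carrier R" "b \<otimes> m \<oplus> h \<otimes> n = \<one>" by (rule comaxE)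
  have "(b <# carrier R) <+>\<^bsub>R\<^esub> (h <# carrier R) = carrier R"
  proof
    show "(b <# carrier R) <+>\<^bsub>R\<^esub> (h <# carrier R) \<subseteq> carrier R"
      using carr h(1) by (auto simp: set_add_def' l_coset_def)
    show "carrier R \<subseteq> (b <# carrier R) <+>\<^bsub>R\<^esub> (h <# carrier R)"
    proof
      fix t assume t: "t \<in> carrier R"
      have "t = (b \<otimes> m \<oplus> h \<otimes> n) \<otimes> t" using mn t by simp
      also have "\<dots> = b \<otimes> (m \<otimes> t) \<oplus> h \<otimes> (n \<otimes> t)"
        using mn(1,2) t carr(2) h(1) by (simp add: l_distr m_assoc)
      finally have "t = b \<otimes> (m \<otimes> t) \<oplus> h \<otimes> (n \<otimes> t)" .
      then show "t \<in> (b <# carrier R) <+>\<^bsub>R\<^esub> (h <# carrier R)"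
        using mn(1,2) t unfolding set_add_def' l_coset_def by auto
    qed
  qed
  then obtain t where t: "t \<in> carrier R" "PM_element R (b \<oplus> h \<otimes> t)"
    using G carr(2) h(1) unfolding gelfand_range_1_def by blast
  let ?b = "b \<oplus> h \<otimes> t"
  have "d \<rightharpoonup> \<one>" if d: "d \<rightharpoonup> a" "d \<rightharpoonup> ?b" "d \<rightharpoonup> c" for d
  proof -
    have "d \<rightharpoonup> a \<otimes> x \<oplus> c \<otimes> y" using d h(4,5) by (simp add: rdvd_add rdvd_mult_right)
    then have "d \<rightharpoonup> h \<otimes> t" using h(8) t(1) by (simp add: rdvd_mult_right)
    then have "d \<rightharpoonup> b" using d(2) carr(2) h(1) t(1) rdvd_addD[of d "h \<otimes> t" b] by (simp add: a_comm)
    then show ?thesis using gcd d by blast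
  qed
  then obtain u q where uq: "u \<in> carrier R" "q \<in> carrier R" "a \<otimes> u \<bowtie> ?b \<otimes> u \<oplus> c \<otimes> q"
    using PM_triangular[OF t(2) carr(1,3)] by metis
  \<comment> \<open>Since \<open>h t = a x t + c y t\<close>, the part with \<open>c\<close> is
    absorbed into \<open>?q\<close>, and the part with \<open>a\<close> contributes the multiple
    \<open>w (a u)\<close> of \<open>a u\<close>.\<close>
  let ?q = "y \<otimes> t \<otimes> u \<oplus> q"
  obtain w where w: "w \<in> carrier R" "a \<otimes> (x \<otimes> t) = w \<otimes> a"
    using duo_left[of a "x \<otimes> t"] carr h(4) t(1) by auto
  have "h \<otimes> t = w \<otimes> a \<oplus> c \<otimes> (y \<otimes> t)"
    using carr h(4,5) t(1) by (simp add: l_distr m_assoc flip: h(8) w(2))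
  then have "?b \<otimes> u \<oplus> c \<otimes> q = (b \<otimes> u \<oplus> c \<otimes> ?q) \<oplus> w \<otimes> (a \<otimes> u)"
    using carr h(5) t(1) uq(1,2) w(1) by (simp add: l_distr r_distr m_assoc a_ac)
  moreover have "a \<otimes> u \<rightharpoonup> w \<otimes> (a \<otimes> u)" using w(1) carr uq(1) by (simp add: rdvd_mult_left)
  ultimately have "a \<otimes> u \<bowtie> b \<otimes> u \<oplus> c \<otimes> ?q"
    using uq comax_cong_iff[of "b \<otimes> u \<oplus> c \<otimes> ?q" "a \<otimes> u" "w \<otimes> (a \<otimes> u)"] carr h(5) t(1) by simp
  then show ?thesis using that[of u ?q] uq h(5) t(1) by simp
qed

text \<open>The column \<open>(a p + b q, c q)\<close> is the product of the matrix with rows \<open>(a, b)\<close> and \<open>(0, c)\<close>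
  with \<open>(p, q)\<close>.\<close>

lemma triangular_gcd_column:
  assumes G: "gelfand_range_1 R" and carr: "a \<in> carrier R" "b \<in> carrier R" "c \<in> carrier R"
  obtains p q where "p \<bowtie> q"
    "\<And>d. \<lbrakk>d \<rightharpoonup> a \<otimes> p \<oplus> b \<otimes> q; d \<rightharpoonup> c \<otimes> q\<rbrakk> \<Longrightarrow> d \<rightharpoonup> a \<and> d \<rightharpoonup> b \<and> d \<rightharpoonup> c"
proof -
  obtain h r s x y where h: "h \<in> carrier R" "r \<in> carrier R" "s \<in> carrier R" "x \<in> carrier R"
    "y \<in> carrier R" "a = h \<otimes> r" "b = h \<otimes> s" "a \<otimes> x \<oplus> b \<otimes> y = h"
    using bezout[OF carr(1,2)] by blast
  show ?thesis
  proof (cases "h = \<zero> \<and> c = \<zero>")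
    case True
    then show ?thesis using h comax_one[of \<one>]
      by (intro that[of \<one> \<zero>]) (auto simp: comax_sym dest: rdvd_carrier)
  next
    case False
    \<comment> \<open>\<open>f\<close> is a gcd of \<open>a\<close>, \<open>b\<close> and
      \<open>c\<close>; what is left after division by it has only trivial common divisors.\<close>
    obtain f h1 c1 where f: "f \<in> carrier R" "h1 \<in> carrier R" "c1 \<in> carrier R"
      "h = f \<otimes> h1" "c = f \<otimes> c1" "h1 \<bowtie> c1" "f \<noteq> \<zero>"
      using gcd_factor[OF h(1) carr(3) False] by metis
    let ?a = "h1 \<otimes> r" and ?b = "h1 \<otimes> s"
    have ab: "a = f \<otimes> ?a" "b = f \<otimes> ?b" using h(2,3,6,7) f by (simp_all add: m_assoc)
    have "f \<otimes> (?a \<otimes> x \<oplus> ?b \<otimes> y) = f \<otimes> h1"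
      using h(2-5,8) ab f(1-4) by (simp add: r_distr m_assoc)
    then have h1: "?a \<otimes> x \<oplus> ?b \<otimes> y = h1"
      by (rule cancel_left[rotated 3]) (use f h(2-5) in simp_all)
    have "d \<rightharpoonup> \<one>" if d: "d \<rightharpoonup> c1" "d \<rightharpoonup> ?b" "d \<rightharpoonup> ?a" for d
    proof -
      have "d \<rightharpoonup> h1"
        using rdvd_add[OF rdvd_mult_right[OF d(3) h(4)] rdvd_mult_right[OF d(2) h(5)]] h1 by simp
      then show ?thesis using comax_common[OF f(6)] d by blast
    qed
    \<comment> \<open>The triangular lemma is used with the diagonal entries interchanged: its
      \<open>q\<close> becomes the first entry of the column and its \<open>u\<close> the
      second.\<close>
    then obtain u q where uq: "u \<in> carrier R" "q \<in> carrier R" "c1 \<otimes> u \<bowtie> ?b \<otimes> u \<oplus> ?a \<otimes> q"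
      using gelfand_triangular[OF G, of c1 ?b ?a] f h(2,3) by auto
    have "q \<bowtie> u"
      by (rule comaxI_common)
        (use uq f(2,3) h(2,3) in \<open>auto intro!: comax_common[OF uq(3)] simp: rdvd_mult_left rdvd_add\<close>)
    moreover have "d \<rightharpoonup> a \<and> d \<rightharpoonup> b \<and> d \<rightharpoonup> c"
      if d: "d \<rightharpoonup> a \<otimes> q \<oplus> b \<otimes> u" "d \<rightharpoonup> c \<otimes> u" for d
    proof -
      \<comment> \<open>Multiplying the Bezout identity by \<open>f\<close> expresses
        \<open>f\<close> through the two entries of the product column.\<close>
      obtain m n where mn: "m \<in> carrier R" "n \<in> carrier R"
        "c1 \<otimes> u \<otimes> m \<oplus> (?b \<otimes> u \<oplus> ?a \<otimes> q) \<otimes> n = \<one>" using uq(3) by (rule comaxE)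
      have "f = f \<otimes> (c1 \<otimes> u \<otimes> m \<oplus> (?b \<otimes> u \<oplus> ?a \<otimes> q) \<otimes> n)" using mn(3) f(1) by simp
      also have "\<dots> = f \<otimes> (c1 \<otimes> u) \<otimes> m \<oplus> f \<otimes> (?b \<otimes> u \<oplus> ?a \<otimes> q) \<otimes> n"
        using f(1-3) h(2,3) uq(1,2) mn(1,2) by (simp add: r_distr l_distr m_assoc)
      also have "f \<otimes> (c1 \<otimes> u) = c \<otimes> u" using f(1,3,5) uq by (simp add: m_assoc)
      also have "f \<otimes> (?b \<otimes> u \<oplus> ?a \<otimes> q) = a \<otimes> q \<oplus> b \<otimes> u"
        unfolding ab using f(1,2) h(2,3) uq(1,2) by (simp add: r_distr m_assoc a_comm)
      finally have "d \<rightharpoonup> f"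
        using rdvd_add[OF rdvd_mult_right[OF d(2) mn(1)] rdvd_mult_right[OF d(1) mn(2)]] by simp
      then show ?thesis unfolding ab f(5) using f(1-3) h(2,3) by (simp add: rdvd_mult_right)
    qed
    ultimately show ?thesis using that by blast
  qed
qed

section \<open>Diagonal reduction by invertible row and column operations\<close>

text \<open>Matrices are handled as functions on all pairs of indices; only the entries inside the
  \<open>m\<close> by \<open>n\<close> rectangle are meaningful.\<close>

fun rowop :: "nat \<Rightarrow> nat \<Rightarrow> 'a \<times> 'a \<times> 'a \<times> 'a \<Rightarrow> (nat \<Rightarrow> nat \<Rightarrow> 'a) \<Rightarrow> nat \<Rightarrow> nat \<Rightarrow> 'a" where
  "rowop i j (p, q, r, s) A = (\<lambda>x y. if x = i then p \<otimes> A i y \<oplus> q \<otimes> A j y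
     else if x = j then r \<otimes> A i y \<oplus> s \<otimes> A j y else A x y)"

fun colop :: "nat \<Rightarrow> nat \<Rightarrow> 'a \<times> 'a \<times> 'a \<times> 'a \<Rightarrow> (nat \<Rightarrow> nat \<Rightarrow> 'a) \<Rightarrow> nat \<Rightarrow> nat \<Rightarrow> 'a" where
  "colop i j (p, q, r, s) A = (\<lambda>x y. if y = i then A x i \<otimes> p \<oplus> A x j \<otimes> r
     else if y = j then A x i \<otimes> q \<oplus> A x j \<otimes> s else A x y)"

text \<open>Only rows in \<open>{k..<m}\<close> and columns in \<open>{l..<n}\<close> may be
  touched, which protects finished parts of the matrix. With \<open>l = n\<close> the column range
  is empty and only row operations remain.\<close>

inductive ops :: "nat \<Rightarrow> nat \<Rightarrow> nat \<Rightarrow> nat \<Rightarrow> (nat \<Rightarrow> nat \<Rightarrow> 'a) \<Rightarrow> (nat \<Rightarrow> nat \<Rightarrow> 'a) \<Rightarrow> bool"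
  for m n k l A where
  refl: "ops m n k l A A"
| row: "\<lbrakk>ops m n k l A B; i \<in> {k..<m}; j \<in> {k..<m}; i \<noteq> j; inv_pair T S\<rbrakk> \<Longrightarrow>
    ops m n k l A (rowop i j T B)"
| col: "\<lbrakk>ops m n k l A B; i \<in> {l..<n}; j \<in> {l..<n}; i \<noteq> j; inv_pair T S\<rbrakk> \<Longrightarrow>
    ops m n k l A (colop i j T B)"

section \<open>Reversibility and invariants of the operations\<close>

abbreviation entries :: "(nat \<Rightarrow> nat \<Rightarrow> 'a) \<Rightarrow> bool" where
  "entries A \<equiv> \<forall>x y. A x y \<in> carrier R"

lemma rowop_entries: "\<lbrakk>entries A; inv_pair T S\<rbrakk> \<Longrightarrow> entries (rowop i j T A)"
  by (cases T; cases S) simp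

lemma colop_entries: "\<lbrakk>entries A; inv_pair T S\<rbrakk> \<Longrightarrow> entries (colop i j T A)"
  by (cases T; cases S) simp

lemma combine_left:
  "\<lbrakk>{p, q, r, s, p', q', a, b} \<subseteq> carrier R\<rbrakk> \<Longrightarrow>
    p' \<otimes> (p \<otimes> a \<oplus> q \<otimes> b) \<oplus> q' \<otimes> (r \<otimes> a \<oplus> s \<otimes> b) =
    (p' \<otimes> p \<oplus> q' \<otimes> r) \<otimes> a \<oplus> (p' \<otimes> q \<oplus> q' \<otimes> s) \<otimes> b"
  by (simp add: l_distr r_distr m_assoc a_ac)

lemma combine_right:
  "\<lbrakk>{p, q, r, s, p', q', a, b} \<subseteq> carrier R\<rbrakk> \<Longrightarrow>
    (a \<otimes> p \<oplus> b \<otimes> q) \<otimes> p' \<oplus> (a \<otimes> r \<oplus> b \<otimes> s) \<otimes> q' =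
    a \<otimes> (p \<otimes> p' \<oplus> r \<otimes> q') \<oplus> b \<otimes> (q \<otimes> p' \<oplus> s \<otimes> q')"
  by (simp add: l_distr r_distr m_assoc a_ac)

lemma rowop_inverse:
  assumes "entries A" "inv_pair T S" "i \<noteq> j" shows "rowop i j S (rowop i j T A) = A"
proof -
  obtain p q r s where T: "T = (p, q, r, s)" by (cases T)
  obtain p' q' r' s' where S: "S = (p', q', r', s')" by (cases S)
  show ?thesis using assms by (intro ext) (simp add: T S combine_left)
qed

lemma colop_inverse:
  assumes "entries A" "inv_pair T S" "i \<noteq> j" shows "colop i j S (colop i j T A) = A"
proof -
  obtain p q r s where T: "T = (p, q, r, s)" by (cases T)
  obtain p' q' r' s' where S: "S = (p', q', r', s')" by (cases S)
  show ?thesis using assms by (intro ext) (simp add: T S combine_right)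
qed

lemma ops_entries: "\<lbrakk>ops m n k l A B; entries A\<rbrakk> \<Longrightarrow> entries B"
proof (induction rule: ops.induct)
  case (row B i j T S)
  then show ?case using rowop_entries by simp
next
  case (col B i j T S)
  then show ?case using colop_entries by simp
qed simp

lemma ops_mono:
  assumes "ops m n k l A B" "k' \<le> k" "l' \<le> l" shows "ops m n k' l' A B"
  using assms(1)
proof (induction rule: ops.induct)
  case (row B i j T S)
  then show ?case using assms by (intro ops.row) auto
next
  case (col B i j T S)
  then show ?case using assms by (intro ops.col) auto
qed (rule ops.refl)

lemma ops_trans:
  assumes "ops m n k l A B" "ops m n k l B C" shows "ops m n k l A C"
  using assms(2)
proof (induction rule: ops.induct)
  case (row B i j T S)
  then show ?case by (intro ops.row)
next
  case (col B i j T S)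
  then show ?case by (intro ops.col)
qed (rule assms(1))

lemma ops_sym: "\<lbrakk>ops m n k l A B; entries A\<rbrakk> \<Longrightarrow> ops m n k l B A"
proof (induction rule: ops.induct)
  case refl
  show ?case by (rule ops.refl)
next
  case (row B i j T S)
  have "ops m n k l (rowop i j T B) (rowop i j S (rowop i j T B))"
    by (rule ops.row[OF ops.refl row.hyps(2-4) inv_pair_sym[OF row.hyps(5)]])
  then have "ops m n k l (rowop i j T B) B"
    using rowop_inverse[OF ops_entries[OF row.hyps(1) row.prems] row.hyps(5,4)] by simp
  then show ?case using ops_trans row.IH[OF row.prems] by blast
next
  case (col B i j T S)
  have "ops m n k l (colop i j T B) (colop i j S (colop i j T B))"
    by (rule ops.col[OF ops.refl col.hyps(2-4) inv_pair_sym[OF col.hyps(5)]])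
  then have "ops m n k l (colop i j T B) B"
    using colop_inverse[OF ops_entries[OF col.hyps(1) col.prems] col.hyps(5,4)] by simp
  then show ?case using ops_trans col.IH[OF col.prems] by blast
qed

lemma ops_outside:
  assumes "ops m n k l A B" "x \<notin> {k..<m}" "y \<notin> {l..<n}" shows "B x y = A x y"
  using assms(1)
proof (induction rule: ops.induct)
  case (row B i j T S)
  then show ?case using assms(2) by (cases T) auto
next
  case (col B i j T S)
  then show ?case using assms(3) by (cases T) auto
qed simp

text \<open>With \<open>d = 0\<close> this says that blocks of zeros are preserved.\<close>

lemma ops_rdvd:
  assumes "ops m n k l A B"
    and X: "{k..<m} \<subseteq> X \<or> X \<inter> {k..<m} = {}" and Y: "{l..<n} \<subseteq> Y \<or> Y \<inter> {l..<n} = {}"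
    and A: "\<And>x y. \<lbrakk>x \<in> X; y \<in> Y\<rbrakk> \<Longrightarrow> d \<rightharpoonup> A x y"
    and "x \<in> X" "y \<in> Y"
  shows "d \<rightharpoonup> B x y"
  using assms(1,5,6)
proof (induction arbitrary: x y rule: ops.induct)
  case refl
  then show ?case using A by simp
next
  case (row B i j T S)
  obtain p q r s where T: "T = (p, q, r, s)" by (cases T)
  have c: "{p, q, r, s} \<subseteq> carrier R" using row.hyps(5) unfolding T by (cases S) simp
  show ?case
  proof (cases "x \<in> {i, j}")
    case True
    then have "i \<in> X" "j \<in> X" using X row.hyps(2,3) row.prems(1) by auto
    then show ?thesis using row.IH[of _ y] row.prems c T by (simp add: rdvd_add rdvd_mult_left)
  next
    case False
    then show ?thesis using row.IH[of x y] row.prems by (simp add: T)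
  qed
next
  case (col B i j T S)
  obtain p q r s where T: "T = (p, q, r, s)" by (cases T)
  have c: "{p, q, r, s} \<subseteq> carrier R" using col.hyps(5) unfolding T by (cases S) simp
  show ?case
  proof (cases "y \<in> {i, j}")
    case True
    then have "i \<in> Y" "j \<in> Y" using Y col.hyps(2,3) col.prems(2) by auto
    then show ?thesis using col.IH[of x] col.prems c T by (simp add: rdvd_add rdvd_mult_right)
  next
    case False
    then show ?thesis using col.IH[of x y] col.prems by (simp add: T)
  qed
qed

lemma ops_zero:
  assumes "ops m n k l A B"
    and "{k..<m} \<subseteq> X \<or> X \<inter> {k..<m} = {}" and "{l..<n} \<subseteq> Y \<or> Y \<inter> {l..<n} = {}"
    and "\<And>x y. \<lbrakk>x \<in> X; y \<in> Y\<rbrakk> \<Longrightarrow> A x y = \<zero>"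
    and "x \<in> X" "y \<in> Y"
  shows "B x y = \<zero>"
  using ops_rdvd[OF assms(1-3), of \<zero> x y] assms(4-6) by simp

text \<open>Hermite steps against the pivot row \<open>k\<close> clear the later rows one by one;
  \<open>h\<close> bounds the rows already treated.\<close>

lemma column_reduction:
  assumes "entries A" "k < m"
  obtains B where "ops m n k n A B" "\<And>x. \<lbrakk>k < x; x < m\<rbrakk> \<Longrightarrow> B x j = \<zero>"
proof -
  have "\<exists>B. ops m n k n A B \<and> (\<forall>x. k < x \<and> x < h \<longrightarrow> B x j = \<zero>)" if "h \<le> m" for h
    using that
  proof (induction h)
    case 0
    then show ?case using ops.refl by blast
  next
    case (Suc h)
    then obtain B where B: "ops m n k n A B" "\<And>x. \<lbrakk>k < x; x < h\<rbrakk> \<Longrightarrow> B x j = \<zero>" by auto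
    show ?case
    proof (cases "k < h")
      case False
      then show ?thesis using B(1) by (intro exI[of _ B]) auto
    next
      case True
      have "entries B" using ops_entries[OF B(1) assms(1)] .
      then obtain p q r s S where T: "inv_pair (p, q, r, s) S" "r \<otimes> B k j \<oplus> s \<otimes> B h j = \<zero>"
        using hermite_column[of "B k j" "B h j"] by metis
      have "ops m n k n A (rowop k h (p, q, r, s) B)"
        using B(1) True Suc.prems T(1) by (intro ops.row) auto
      moreover have "rowop k h (p, q, r, s) B x j = \<zero>" if "k < x" "x < Suc h" for x
        using B(2)[of x] T(2) that by (cases "x = h") auto
      ultimately show ?thesis by blast
    qed
  qed
  from this[of m] show ?thesis using that by blast
qed

text \<open>The block grows leftwards from the last column. Row operations reduce columns
  \<open>j\<close> and \<open>Suc j\<close> to a triangular two by two block; a column operation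
  then gives column \<open>j\<close> the gcd of that block, which divides the old pivot and so the
  whole enlarged block.\<close>

lemma pivot:
  assumes G: "gelfand_range_1 R" and A: "entries A" and k: "k < m" and j: "j < n"
  shows "\<exists>B. ops m n k j A B \<and> (\<forall>x y. k \<le> x \<and> x < m \<and> j \<le> y \<and> y < n \<longrightarrow> B k j \<rightharpoonup> B x y) \<and>
    (\<forall>x. k < x \<and> x < m \<longrightarrow> B x j = \<zero>)"
proof -
  have "j \<le> n - 1" using j by simp
  then show ?thesis
  proof (induction rule: inc_induct)
    case base
    obtain B where B: "ops m n k n A B" "\<And>x. \<lbrakk>k < x; x < m\<rbrakk> \<Longrightarrow> B x (n - 1) = \<zero>"
      using column_reduction[OF A k, of n "n - 1"] by blast
    have "entries B" using ops_entries[OF B(1) A] .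
    then have "B k (n - 1) \<rightharpoonup> B x y" if "k \<le> x" "x < m" "n - 1 \<le> y" "y < n" for x y
    proof -
      have "y = n - 1" using that by simp
      then show ?thesis using B(2)[of x] that \<open>entries B\<close> by (cases "x = k") auto
    qed
    then show ?case using B ops_mono[OF B(1), of k "n - 1"] by auto
  next
    case (step j)
    have j: "Suc j < n" using step.hyps by simp
    obtain B where B: "ops m n k (Suc j) A B"
      "\<And>x y. \<lbrakk>k \<le> x; x < m; Suc j \<le> y; y < n\<rbrakk> \<Longrightarrow> B k (Suc j) \<rightharpoonup> B x y"
      using step.IH by blast
    have eB: "entries B" using ops_entries[OF B(1) A] .
    obtain C where C: "ops m n k n B C" "\<And>x. \<lbrakk>k < x; x < m\<rbrakk> \<Longrightarrow> C x j = \<zero>"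
      using column_reduction[OF eB k, of n j] by blast
    have eC: "entries C" using ops_entries[OF C(1) eB] .
    \<comment> \<open>Only rows of index above \<open>k\<close> are used, so column
      \<open>j\<close>, already zero there, stays cleared.\<close>
    obtain D where D: "ops m n (Suc k) n C D" "\<And>x. \<lbrakk>Suc k < x; x < m\<rbrakk> \<Longrightarrow> D x (Suc j) = \<zero>"
    proof (cases "Suc k < m")
      case True
      show ?thesis by (rule column_reduction[OF eC True, of n "Suc j"]) (rule that)
    next
      case False
      show ?thesis by (rule that[OF ops.refl]) (use False in auto)
    qed
    have eD: "entries D" using ops_entries[OF D(1) eC] .
    have Dj: "D x j = \<zero>" if "k < x" "x < m" for x
      using that C(2) by (intro ops_zero[OF D(1), of "{Suc k..<m}" "{j}"]) auto
    have BD: "ops m n k n B D" using ops_trans[OF C(1) ops_mono[OF D(1)]] by simp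
    \<comment> \<open>With no row beyond \<open>k\<close>, the missing corner of the triangular
      block is taken to be zero.\<close>
    define c where "c = (if Suc k < m then D (Suc k) (Suc j) else \<zero>)"
    have c: "c \<in> carrier R" using eD by (simp add: c_def)
    obtain p q where pq: "p \<bowtie> q" "\<And>d. \<lbrakk>d \<rightharpoonup> D k j \<otimes> p \<oplus> D k (Suc j) \<otimes> q; d \<rightharpoonup> c \<otimes> q\<rbrakk> \<Longrightarrow>
        d \<rightharpoonup> D k j \<and> d \<rightharpoonup> D k (Suc j) \<and> d \<rightharpoonup> c"
      using triangular_gcd_column[OF G, of "D k j" "D k (Suc j)" c] eD c by metis
    have pqc: "p \<in> carrier R" "q \<in> carrier R" using pq(1) comax_carrier by auto
    obtain p' q' r' s' u v where T: "inv_pair (p', q', r', s') (p, u, q, v)"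
      using comax_column_completion[OF pq(1)] by metis
    define E where "E = colop j (Suc j) (p, u, q, v) D"
    have DE: "ops m n k j D E"
      unfolding E_def using j by (intro ops.col[OF ops.refl _ _ _ inv_pair_sym[OF T]]) auto
    have eE: "entries E" using ops_entries[OF DE eD] .
    have Ej: "E x j = D x j \<otimes> p \<oplus> D x (Suc j) \<otimes> q" for x by (simp add: E_def)
    obtain F where F: "ops m n k n E F" "\<And>x. \<lbrakk>k < x; x < m\<rbrakk> \<Longrightarrow> F x j = \<zero>"
      using column_reduction[OF eE k, of n j] by blast
    have eF: "entries F" using ops_entries[OF F(1) eE] .
    let ?d = "F k j"
    have "?d \<rightharpoonup> F x j" if "x \<in> {k..<m}" for x
      using F(2)[of x] that eF by (cases "x = k") auto
    \<comment> \<open>Row operations are reversible, so divisibility by \<open>?d\<close> pulls back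
      from \<open>F\<close> to \<open>E\<close>.\<close>
    then have dE: "?d \<rightharpoonup> E x j" if "x \<in> {k..<m}" for x
      using that by (intro ops_rdvd[OF ops_sym[OF F(1) eE], of "{k..<m}" "{j}"]) auto
    have "?d \<rightharpoonup> c \<otimes> q"
    proof (cases "Suc k < m")
      case True
      then show ?thesis using dE[of "Suc k"] Dj[of "Suc k"] pqc eD by (simp add: c_def Ej)
    next
      case False
      then show ?thesis using eF pqc by (simp add: c_def)
    qed
    then have d: "?d \<rightharpoonup> D k j" "?d \<rightharpoonup> D k (Suc j)" "?d \<rightharpoonup> c"
      using pq(2) dE[of k] k by (simp_all add: Ej)
    have "?d \<rightharpoonup> D x (Suc j)" if "x \<in> {k..<m}" for x
    proof -
      have "x = k \<or> x = Suc k \<or> Suc k < x" using that by auto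
      then consider "x = k" | "x = Suc k" | "Suc k < x" by blast
      then show ?thesis using that d D(2)[of x] eF by cases (auto simp: c_def)
    qed
    \<comment> \<open>Pulling back further to \<open>B\<close>, whose old pivot divides all later
      columns of the block, extends divisibility by \<open>?d\<close> to those columns.\<close>
    then have "?d \<rightharpoonup> B k (Suc j)"
      using k by (intro ops_rdvd[OF ops_sym[OF BD eB], of "{k..<m}" "{Suc j}"]) auto
    then have "?d \<rightharpoonup> B x y" if "x \<in> {k..<m}" "y \<in> {Suc j..<n}" for x y
      using rdvd_trans[OF _ B(2)[of x y]] that by simp
    then have dD: "?d \<rightharpoonup> D x y" if "x \<in> {k..<m}" "y \<in> {Suc j..<n}" for x y
      using that by (intro ops_rdvd[OF BD, of "{k..<m}" "{Suc j..<n}"]) auto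
    have "?d \<rightharpoonup> D x y" if "x \<in> {k..<m}" "y \<in> {j..<n}" for x y
    proof (cases "y = j")
      case True
      then show ?thesis using that d(1) Dj[of x] eF by (cases "x = k") auto
    next
      case False
      then show ?thesis using dD that by simp
    qed
    moreover have DF: "ops m n k j D F" using ops_trans[OF DE ops_mono[OF F(1)]] j by simp
    ultimately have "?d \<rightharpoonup> F x y" if "x \<in> {k..<m}" "y \<in> {j..<n}" for x y
      using that by (intro ops_rdvd[OF DF, of "{k..<m}" "{j..<n}"]) auto
    moreover have "ops m n k j A F"
      using ops_trans[OF ops_trans[OF ops_mono[OF B(1), of k j] ops_mono[OF BD, of k j]] DF] j by simp
    ultimately show ?case using F(2) by (intro exI[of _ F]) auto
  qed
qed

text \<open>Each entry of row \<open>k\<close> is a right multiple of the pivot, so subtracting a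
  right multiple of column \<open>k\<close> clears it. Column \<open>k\<close> itself never changes,
  and divisibility by the pivot persists in the block.\<close>

lemma clear_row:
  assumes C: "entries C" and k: "k < m" "k < n"
    and dvd: "\<And>x y. \<lbrakk>x \<in> {k..<m}; y \<in> {k..<n}\<rbrakk> \<Longrightarrow> C k k \<rightharpoonup> C x y"
  obtains B where "ops m n k k C B" "\<And>x. B x k = C x k" "\<And>y. \<lbrakk>k < y; y < n\<rbrakk> \<Longrightarrow> B k y = \<zero>"
proof -
  have "\<exists>B. ops m n k k C B \<and> (\<forall>x. B x k = C x k) \<and> (\<forall>y. k < y \<and> y < h \<longrightarrow> B k y = \<zero>)"
    if "h \<le> n" for h
    using that
  proof (induction h)
    case 0
    then show ?case using ops.refl by blast
  next
    case (Suc h)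
    then obtain B where B: "ops m n k k C B" "\<And>x. B x k = C x k"
      "\<And>y. \<lbrakk>k < y; y < h\<rbrakk> \<Longrightarrow> B k y = \<zero>" by auto
    show ?case
    proof (cases "k < h")
      case False
      then show ?thesis using B by (intro exI[of _ B]) auto
    next
      case True
      have eB: "entries B" using ops_entries[OF B(1) C] .
      have "C k k \<rightharpoonup> B k h"
        using k True Suc.prems dvd by (intro ops_rdvd[OF B(1), of "{k..<m}" "{k..<n}"]) auto
      then obtain z where z: "z \<in> carrier R" "B k h = C k k \<otimes> z" by (rule rdvdE)
      let ?B = "colop k h (\<one>, \<ominus> z, \<zero>, \<one>) B"
      have inv: "inv_pair (\<one>, \<ominus> z, \<zero>, \<one>) (\<one>, z, \<zero>, \<one>)" using z(1) by (simp add: r_neg l_neg)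
      have "ops m n k k C ?B"
        by (rule ops.col[OF B(1) _ _ _ inv]) (use True Suc.prems in auto)
      moreover have "?B x k = C x k" for x using B(2) eB C by simp
      moreover have "?B k y = \<zero>" if "k < y" "y < Suc h" for y
        using B(2)[of k] B(3)[of y] z C that by (cases "y = h") (auto simp: r_minus l_neg)
      ultimately show ?thesis by blast
    qed
  qed
  from this[of n] show ?thesis using that by blast
qed

lemma diagonal_ops:
  assumes G: "gelfand_range_1 R" and A: "entries A"
  obtains D where "ops m n 0 0 A D"
    "\<And>x y. \<lbrakk>x < m; y < n; x \<noteq> y\<rbrakk> \<Longrightarrow> D x y = \<zero>"
    "\<And>i. Suc i < min m n \<Longrightarrow> D i i \<rightharpoonup> D (Suc i) (Suc i)"
proof -
  \<comment> \<open>The first \<open>k\<close> diagonal positions are finished. The last clause,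
    vacuous for \<open>k = 0\<close>, says that the newest pivot divides the remaining block; it
    supplies the next link of the divisibility chain.\<close>
  let ?P = "\<lambda>k B. ops m n 0 0 A B \<and>
    (\<forall>x y. x < m \<and> y < n \<and> x \<noteq> y \<and> (x < k \<or> y < k) \<longrightarrow> B x y = \<zero>) \<and>
    (\<forall>i. Suc i < k \<longrightarrow> B i i \<rightharpoonup> B (Suc i) (Suc i)) \<and>
    (\<forall>i x y. Suc i = k \<and> x \<in> {k..<m} \<and> y \<in> {k..<n} \<longrightarrow> B i i \<rightharpoonup> B x y)"
  have "\<exists>B. ?P k B" if "k \<le> min m n" for k
    using that
  proof (induction k)
    case 0
    then show ?case using ops.refl by (intro exI[of _ A]) auto
  next
    case (Suc k)
    then have k: "k < m" "k < n" by auto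
    obtain B where B: "ops m n 0 0 A B"
      "\<And>x y. \<lbrakk>x < m; y < n; x \<noteq> y; x < k \<or> y < k\<rbrakk> \<Longrightarrow> B x y = \<zero>"
      "\<And>i. Suc i < k \<Longrightarrow> B i i \<rightharpoonup> B (Suc i) (Suc i)"
      "\<And>i x y. \<lbrakk>Suc i = k; x \<in> {k..<m}; y \<in> {k..<n}\<rbrakk> \<Longrightarrow> B i i \<rightharpoonup> B x y"
      using Suc by auto
    have eB: "entries B" using ops_entries[OF B(1) A] .
    obtain C where C: "ops m n k k B C"
      "\<And>x y. \<lbrakk>x \<in> {k..<m}; y \<in> {k..<n}\<rbrakk> \<Longrightarrow> C k k \<rightharpoonup> C x y"
      "\<And>x. \<lbrakk>k < x; x < m\<rbrakk> \<Longrightarrow> C x k = \<zero>"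
      using pivot[OF G eB k] by auto
    have eC: "entries C" using ops_entries[OF C(1) eB] .
    obtain F where F: "ops m n k k C F" "\<And>x. F x k = C x k"
      "\<And>y. \<lbrakk>k < y; y < n\<rbrakk> \<Longrightarrow> F k y = \<zero>"
      using clear_row[OF eC k C(2)] by blast
    have BF: "ops m n k k B F" using ops_trans[OF C(1) F(1)] .
    \<comment> \<open>Operations from row and column \<open>k\<close> on fix the finished corner and
      preserve the zero strips next to it.\<close>
    have F0: "F x y = \<zero>" if xy: "x < m" "y < n" "x \<noteq> y" "x < Suc k \<or> y < Suc k" for x y
    proof -
      consider "x < k" "y < k" | "x < k" "k \<le> y" | "k \<le> x" "y < k" | "x = k" "k < y" | "k < x" "y = k"
        using xy by linarith
      then show ?thesis
      proof cases
        case 1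
        then show ?thesis using ops_outside[OF BF, of x y] B(2)[of x y] xy by simp
      next
        case 2
        then show ?thesis using xy B(2) by (intro ops_zero[OF BF, of "{x}" "{k..<n}"]) auto
      next
        case 3
        then show ?thesis using xy B(2) by (intro ops_zero[OF BF, of "{k..<m}" "{y}"]) auto
      next
        case 4
        then show ?thesis using F(3) xy by simp
      next
        case 5
        then show ?thesis using F(2) C(3) xy by simp
      qed
    qed
    have Fd: "F i i = B i i" if "i < k" for i using ops_outside[OF BF, of i i] that by simp
    have FC: "F k k \<rightharpoonup> F x y" if "x \<in> {k..<m}" "y \<in> {k..<n}" for x y
      unfolding F(2) using C(2) that by (intro ops_rdvd[OF F(1), of "{k..<m}" "{k..<n}"]) auto
    have "F i i \<rightharpoonup> F (Suc i) (Suc i)" if "Suc i < Suc k" for i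
    proof (cases "Suc i = k")
      case True
      have "B i i \<rightharpoonup> F k k"
        using B(4)[OF True] k by (intro ops_rdvd[OF BF, of "{k..<m}" "{k..<n}"]) auto
      then show ?thesis using True Fd[of i] by simp
    next
      case False
      then show ?thesis using B(3)[of i] Fd[of i] Fd[of "Suc i"] that by simp
    qed
    moreover have "ops m n 0 0 A F" using ops_trans[OF B(1) ops_mono[OF BF]] by simp
    ultimately show ?case using F0 FC by (intro exI[of _ F]) auto
  qed
  from this[of "min m n"] obtain D where D: "?P (min m n) D" by blast
  show ?thesis
  proof (rule that[of D])
    \<comment> \<open>The smaller of two distinct indices is below \<open>min m n\<close>.\<close>
    show "D x y = \<zero>" if "x < m" "y < n" "x \<noteq> y" for x y
      using D that by (cases "x < y") auto
  qed (use D in auto)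
qed

section \<open>Operations as matrix products\<close>

abbreviation Mat :: "nat \<Rightarrow> nat \<Rightarrow> (nat \<Rightarrow> nat \<Rightarrow> 'a) \<Rightarrow> 'a mat" where
  "Mat m n A \<equiv> mat m n (\<lambda>(i, j). A i j)"

abbreviation delta :: "nat \<Rightarrow> nat \<Rightarrow> 'a" where
  "delta i j \<equiv> if i = j then \<one> else \<zero>"

lemma Mat_mats_over: "entries A \<Longrightarrow> Mat m n A \<in> mats_over R m n"
  by (auto simp: mats_over_def elements_mat_def)

text \<open>Padding with zero outside the rectangle makes the function take values in the ring
  everywhere, as \<open>entries\<close> demands.\<close>

lemma mats_overE:
  assumes "X \<in> mats_over R m n" obtains A where "entries A" "X = Mat m n A"
proof
  let ?A = "\<lambda>i j. if i < m \<and> j < n then X $$ (i, j) else \<zero>"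
  have X: "X \<in> carrier_mat m n" "elements_mat X \<subseteq> carrier R" using assms by (auto simp: mats_over_def)
  then show "X = Mat m n ?A" by (intro eq_matI) auto
  have "X $$ (i, j) \<in> carrier R" if "i < m" "j < n" for i j
    using elements_matI[OF X(1) that] X(2) by blast
  then show "entries ?A" by simp
qed

lemma mat_mult_Mat:
  assumes "entries A" "entries B"
  shows "mat_mult_over R (Mat m n A) (Mat n l B) = Mat m l (\<lambda>i j. \<Oplus>k\<in>{..<n}. A i k \<otimes> B k j)"
  unfolding mat_mult_over_def using assms
  by (intro eq_matI) (auto intro!: finsum_cong')

lemma finsum_swap:
  assumes "finite I" "finite J" "\<And>i j. f i j \<in> carrier R"
  shows "(\<Oplus>i\<in>I. \<Oplus>j\<in>J. f i j) = (\<Oplus>j\<in>J. \<Oplus>i\<in>I. f i j)"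
  using assms(1)
proof (induction I rule: finite_induct)
  case empty
  then show ?case by (simp add: finsum_zero')
next
  case (insert i I)
  then have "(\<Oplus>i\<in>insert i I. \<Oplus>j\<in>J. f i j) = (\<Oplus>j\<in>J. f i j) \<oplus> (\<Oplus>j\<in>J. \<Oplus>i\<in>I. f i j)"
    using assms(3) by simp
  also have "\<dots> = (\<Oplus>j\<in>J. f i j \<oplus> (\<Oplus>i\<in>I. f i j))"
    using assms(3) by (subst finsum_addf) auto
  also have "\<dots> = (\<Oplus>j\<in>J. \<Oplus>i\<in>insert i I. f i j)"
    using insert assms(3) by simp
  finally show ?case .
qed

lemma mat_mult_assoc:
  assumes "X \<in> mats_over R m n" "Y \<in> mats_over R n l" "Z \<in> mats_over R l h"
  shows "mat_mult_over R (mat_mult_over R X Y) Z = mat_mult_over R X (mat_mult_over R Y Z)"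
proof -
  obtain A where A: "entries A" "X = Mat m n A" using assms(1) by (rule mats_overE)
  obtain B where B: "entries B" "Y = Mat n l B" using assms(2) by (rule mats_overE)
  obtain C where C: "entries C" "Z = Mat l h C" using assms(3) by (rule mats_overE)
  have "(\<Oplus>k\<in>{..<l}. (\<Oplus>t\<in>{..<n}. A i t \<otimes> B t k) \<otimes> C k j) =
    (\<Oplus>t\<in>{..<n}. A i t \<otimes> (\<Oplus>k\<in>{..<l}. B t k \<otimes> C k j))" for i j
  proof -
    have "(\<Oplus>k\<in>{..<l}. (\<Oplus>t\<in>{..<n}. A i t \<otimes> B t k) \<otimes> C k j) =
      (\<Oplus>k\<in>{..<l}. \<Oplus>t\<in>{..<n}. A i t \<otimes> B t k \<otimes> C k j)"
      using A B C by (intro finsum_cong') (auto simp: finsum_ldistr)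
    also have "\<dots> = (\<Oplus>t\<in>{..<n}. \<Oplus>k\<in>{..<l}. A i t \<otimes> B t k \<otimes> C k j)"
      using A B C by (intro finsum_swap) auto
    also have "\<dots> = (\<Oplus>t\<in>{..<n}. A i t \<otimes> (\<Oplus>k\<in>{..<l}. B t k \<otimes> C k j))"
      using A B C by (intro finsum_cong') (auto simp: finsum_rdistr m_assoc)
    finally show ?thesis .
  qed
  then show ?thesis using A B C by (simp add: mat_mult_Mat)
qed

lemma mat_mult_mats_over:
  assumes "X \<in> mats_over R m n" "Y \<in> mats_over R n l" shows "mat_mult_over R X Y \<in> mats_over R m l"
proof -
  obtain A where A: "entries A" "X = Mat m n A" using assms(1) by (rule mats_overE)
  obtain B where B: "entries B" "Y = Mat n l B" using assms(2) by (rule mats_overE)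
  show ?thesis using A B by (simp add: mat_mult_Mat Mat_mats_over)
qed

lemma delta_sum_left:
  "\<lbrakk>i < n; \<And>k. f k \<in> carrier R\<rbrakk> \<Longrightarrow> (\<Oplus>k\<in>{..<n}. delta i k \<otimes> f k) = f i"
  using add.finprod_singleton[of i "{..<n}" f]
  by (subst finsum_cong'[of _ _ "\<lambda>k. if i = k then f k else \<zero>"]) auto

lemma delta_sum_right:
  "\<lbrakk>i < n; \<And>k. f k \<in> carrier R\<rbrakk> \<Longrightarrow> (\<Oplus>k\<in>{..<n}. f k \<otimes> delta k i) = f i"
  using add.finprod_singleton_swap[of i "{..<n}" f]
  by (subst finsum_cong'[of _ _ "\<lambda>k. if k = i then f k else \<zero>"]) auto

lemma one_mat_over_Mat: "one_mat_over R n = Mat n n delta"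
  by (simp add: one_mat_over_def)

lemma mat_mult_one:
  assumes "X \<in> mats_over R m n"
  shows "mat_mult_over R (one_mat_over R m) X = X" "mat_mult_over R X (one_mat_over R n) = X"
proof -
  obtain A where A: "entries A" "X = Mat m n A" using assms by (rule mats_overE)
  show "mat_mult_over R (one_mat_over R m) X = X" "mat_mult_over R X (one_mat_over R n) = X"
    using A by (auto simp: one_mat_over_Mat mat_mult_Mat delta_sum_left delta_sum_right intro!: eq_matI)
qed

lemma one_mat_invertible: "invertible_mat_over R n (one_mat_over R n)"
proof -
  have "one_mat_over R n \<in> mats_over R n n"
    unfolding one_mat_over_Mat by (rule Mat_mats_over) simp
  then show ?thesis using mat_mult_one unfolding invertible_mat_over_def by blast
qed

lemma invertible_mat_mult:
  assumes "invertible_mat_over R n P" "invertible_mat_over R n Q"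
  shows "invertible_mat_over R n (mat_mult_over R P Q)"
proof -
  obtain P' where P: "P \<in> mats_over R n n" "P' \<in> mats_over R n n"
    "mat_mult_over R P P' = one_mat_over R n" "mat_mult_over R P' P = one_mat_over R n"
    using assms(1) by (auto simp: invertible_mat_over_def)
  obtain Q' where Q: "Q \<in> mats_over R n n" "Q' \<in> mats_over R n n"
    "mat_mult_over R Q Q' = one_mat_over R n" "mat_mult_over R Q' Q = one_mat_over R n"
    using assms(2) by (auto simp: invertible_mat_over_def)
  have cancel: "mat_mult_over R (mat_mult_over R X Y) (mat_mult_over R Y' X') = one_mat_over R n"
    if "X \<in> mats_over R n n" "Y \<in> mats_over R n n" "X' \<in> mats_over R n n" "Y' \<in> mats_over R n n"
      "mat_mult_over R X X' = one_mat_over R n" "mat_mult_over R Y Y' = one_mat_over R n" for X Y X' Y'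
  proof -
    have "mat_mult_over R (mat_mult_over R X Y) (mat_mult_over R Y' X') =
      mat_mult_over R X (mat_mult_over R (mat_mult_over R Y Y') X')"
      using mat_mult_assoc[OF that(1,2) mat_mult_mats_over[OF that(4,3)]] mat_mult_assoc[OF that(2,4,3)]
      by simp
    then show ?thesis using that mat_mult_one(1) by simp
  qed
  show ?thesis
    unfolding invertible_mat_over_def
    using cancel[of P Q P' Q'] cancel[of Q' P' Q P] P Q mat_mult_mats_over by blast
qed

text \<open>The elementary matrix is the operation applied to the identity: \<open>two\<close>
  evaluates its two combined rows and \<open>one\<close> the untouched ones.\<close>

lemma rowop_Mat:
  assumes "inv_pair T S" "entries A" "i < m" "j < m"
  shows "mat_mult_over R (Mat m m (rowop i j T delta)) (Mat m n A) = Mat m n (rowop i j T A)"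
proof -
  obtain p q r s where T: "T = (p, q, r, s)" by (cases T)
  have c: "{p, q, r, s} \<subseteq> carrier R" using assms(1) unfolding T by (cases S) simp
  have two: "(\<Oplus>k\<in>{..<m}. (a \<otimes> delta i k \<oplus> b \<otimes> delta j k) \<otimes> A k y) = a \<otimes> A i y \<oplus> b \<otimes> A j y"
    if ab: "a \<in> carrier R" "b \<in> carrier R" for a b y
  proof -
    have "(\<Oplus>k\<in>{..<m}. (a \<otimes> delta i k \<oplus> b \<otimes> delta j k) \<otimes> A k y) =
      (\<Oplus>k\<in>{..<m}. a \<otimes> (delta i k \<otimes> A k y) \<oplus> b \<otimes> (delta j k \<otimes> A k y))"
      using ab assms(2) by (intro finsum_cong') (auto simp: l_distr m_assoc)
    also have "\<dots> = (\<Oplus>k\<in>{..<m}. a \<otimes> (delta i k \<otimes> A k y)) \<oplus> (\<Oplus>k\<in>{..<m}. b \<otimes> (delta j k \<otimes> A k y))"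
      using ab assms(2) by (intro finsum_addf) auto
    also have "\<dots> = a \<otimes> (\<Oplus>k\<in>{..<m}. delta i k \<otimes> A k y) \<oplus> b \<otimes> (\<Oplus>k\<in>{..<m}. delta j k \<otimes> A k y)"
      using ab assms(2) by (subst (1 2) finsum_rdistr) auto
    also have "\<dots> = a \<otimes> A i y \<oplus> b \<otimes> A j y"
      using assms delta_sum_left[of i m "\<lambda>k. A k y"] delta_sum_left[of j m "\<lambda>k. A k y"] by simp
    finally show ?thesis .
  qed
  have one: "(\<Oplus>k\<in>{..<m}. delta x k \<otimes> A k y) = A x y" if "x < m" for x y
    using delta_sum_left[of x m "\<lambda>k. A k y"] that assms(2) by simp
  have "entries (rowop i j T delta)" by (rule rowop_entries[OF _ assms(1)]) simp
  then have "mat_mult_over R (Mat m m (rowop i j T delta)) (Mat m n A) =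
    Mat m n (\<lambda>x y. \<Oplus>k\<in>{..<m}. rowop i j T delta x k \<otimes> A k y)"
    using assms(2) by (rule mat_mult_Mat)
  also have "\<dots> = Mat m n (rowop i j T A)"
  proof (rule eq_matI)
    fix x y assume "x < dim_row (Mat m n (rowop i j T A))" "y < dim_col (Mat m n (rowop i j T A))"
    then have xy: "x < m" "y < n" by simp_all
    consider "x = i" | "x = j" "x \<noteq> i" | "x \<noteq> i" "x \<noteq> j" by blast
    then have "(\<Oplus>k\<in>{..<m}. rowop i j T delta x k \<otimes> A k y) = rowop i j T A x y"
    proof cases
      case 1
      then show ?thesis using two[of p q y] c by (simp only: T rowop.simps if_True) simp
    next
      case 2
      then show ?thesis using two[of r s y] c by (simp only: T rowop.simps if_True if_False) simp
    next
      case 3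
      then show ?thesis using one[OF xy(1), of y] by (simp only: T rowop.simps if_False)
    qed
    then show "Mat m n (\<lambda>x y. \<Oplus>k\<in>{..<m}. rowop i j T delta x k \<otimes> A k y) $$ (x, y) =
      Mat m n (rowop i j T A) $$ (x, y)" using xy by simp
  qed simp_all
  finally show ?thesis .
qed

lemma colop_Mat:
  assumes "inv_pair T S" "entries A" "i < n" "j < n"
  shows "mat_mult_over R (Mat m n A) (Mat n n (colop i j T delta)) = Mat m n (colop i j T A)"
proof -
  obtain p q r s where T: "T = (p, q, r, s)" by (cases T)
  have c: "{p, q, r, s} \<subseteq> carrier R" using assms(1) unfolding T by (cases S) simp
  have two: "(\<Oplus>k\<in>{..<n}. A x k \<otimes> (delta k i \<otimes> a \<oplus> delta k j \<otimes> b)) = A x i \<otimes> a \<oplus> A x j \<otimes> b"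
    if ab: "a \<in> carrier R" "b \<in> carrier R" for a b x
  proof -
    have "(\<Oplus>k\<in>{..<n}. A x k \<otimes> (delta k i \<otimes> a \<oplus> delta k j \<otimes> b)) =
      (\<Oplus>k\<in>{..<n}. A x k \<otimes> delta k i \<otimes> a \<oplus> A x k \<otimes> delta k j \<otimes> b)"
      using ab assms(2) by (intro finsum_cong') (auto simp: r_distr m_assoc)
    also have "\<dots> = (\<Oplus>k\<in>{..<n}. A x k \<otimes> delta k i \<otimes> a) \<oplus> (\<Oplus>k\<in>{..<n}. A x k \<otimes> delta k j \<otimes> b)"
      using ab assms(2) by (intro finsum_addf) auto
    also have "\<dots> = (\<Oplus>k\<in>{..<n}. A x k \<otimes> delta k i) \<otimes> a \<oplus> (\<Oplus>k\<in>{..<n}. A x k \<otimes> delta k j) \<otimes> b"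
      using ab assms(2) by (subst (1 2) finsum_ldistr) auto
    also have "\<dots> = A x i \<otimes> a \<oplus> A x j \<otimes> b"
      using assms delta_sum_right[of i n "\<lambda>k. A x k"] delta_sum_right[of j n "\<lambda>k. A x k"] by simp
    finally show ?thesis .
  qed
  have one: "(\<Oplus>k\<in>{..<n}. A x k \<otimes> delta k y) = A x y" if "y < n" for x y
    using delta_sum_right[of y n "\<lambda>k. A x k"] that assms(2) by simp
  have "entries (colop i j T delta)" by (rule colop_entries[OF _ assms(1)]) simp
  then have "mat_mult_over R (Mat m n A) (Mat n n (colop i j T delta)) =
    Mat m n (\<lambda>x y. \<Oplus>k\<in>{..<n}. A x k \<otimes> colop i j T delta k y)"
    by (rule mat_mult_Mat[OF assms(2)])
  also have "\<dots> = Mat m n (colop i j T A)"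
  proof (rule eq_matI)
    fix x y assume "x < dim_row (Mat m n (colop i j T A))" "y < dim_col (Mat m n (colop i j T A))"
    then have xy: "x < m" "y < n" by simp_all
    consider "y = i" | "y = j" "y \<noteq> i" | "y \<noteq> i" "y \<noteq> j" by blast
    then have "(\<Oplus>k\<in>{..<n}. A x k \<otimes> colop i j T delta k y) = colop i j T A x y"
    proof cases
      case 1
      then show ?thesis using two[of p r x] c by (simp only: T colop.simps if_True) simp
    next
      case 2
      then show ?thesis using two[of q s x] c by (simp only: T colop.simps if_True if_False) simp
    next
      case 3
      then show ?thesis using one[OF xy(2), of x] by (simp only: T colop.simps if_False)
    qed
    then show "Mat m n (\<lambda>x y. \<Oplus>k\<in>{..<n}. A x k \<otimes> colop i j T delta k y) $$ (x, y) =
      Mat m n (colop i j T A) $$ (x, y)" using xy by simp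
  qed simp_all
  finally show ?thesis .
qed

text \<open>Multiplying by one elementary matrix performs its operation on the other, so the inverse
  operation restores the identity.\<close>

lemma rowop_invertible:
  assumes "inv_pair T S" "i < m" "j < m" "i \<noteq> j"
  shows "invertible_mat_over R m (Mat m m (rowop i j T delta))"
proof -
  have e: "entries (rowop i j T delta)" "entries (rowop i j S delta)"
    using rowop_entries[OF _ assms(1)] rowop_entries[OF _ inv_pair_sym[OF assms(1)]] by simp_all
  have d: "entries delta" by simp
  show ?thesis
    unfolding invertible_mat_over_def one_mat_over_Mat
  proof (intro conjI bexI[of _ "Mat m m (rowop i j S delta)"])
    show "mat_mult_over R (Mat m m (rowop i j T delta)) (Mat m m (rowop i j S delta)) = Mat m m delta"
      by (subst rowop_Mat[OF assms(1) e(2) assms(2,3)]) (simp only: rowop_inverse[OF d inv_pair_sym[OF assms(1)] assms(4)])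
    show "mat_mult_over R (Mat m m (rowop i j S delta)) (Mat m m (rowop i j T delta)) = Mat m m delta"
      by (subst rowop_Mat[OF inv_pair_sym[OF assms(1)] e(1) assms(2,3)]) (simp only: rowop_inverse[OF d assms(1,4)])
  qed (rule Mat_mats_over[OF e(1)] Mat_mats_over[OF e(2)])+
qed

lemma colop_invertible:
  assumes "inv_pair T S" "i < n" "j < n" "i \<noteq> j"
  shows "invertible_mat_over R n (Mat n n (colop i j T delta))"
proof -
  have e: "entries (colop i j T delta)" "entries (colop i j S delta)"
    using colop_entries[OF _ assms(1)] colop_entries[OF _ inv_pair_sym[OF assms(1)]] by simp_all
  have d: "entries delta" by simp
  show ?thesis
    unfolding invertible_mat_over_def one_mat_over_Mat
  proof (intro conjI bexI[of _ "Mat n n (colop i j S delta)"])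
    show "mat_mult_over R (Mat n n (colop i j T delta)) (Mat n n (colop i j S delta)) = Mat n n delta"
      by (subst colop_Mat[OF inv_pair_sym[OF assms(1)] e(1) assms(2,3)]) (simp only: colop_inverse[OF d assms(1,4)])
    show "mat_mult_over R (Mat n n (colop i j S delta)) (Mat n n (colop i j T delta)) = Mat n n delta"
      by (subst colop_Mat[OF assms(1) e(2) assms(2,3)]) (simp only: colop_inverse[OF d inv_pair_sym[OF assms(1)] assms(4)])
  qed (rule Mat_mats_over[OF e(1)] Mat_mats_over[OF e(2)])+
qed

text \<open>Each row operation adds a factor on the left of \<open>P\<close>, each column operation
  one on the right of \<open>Q\<close>.\<close>

lemma ops_equivalent:
  assumes "ops m n k l A B" "entries A"
  shows "\<exists>P Q. invertible_mat_over R m P \<and> invertible_mat_over R n Q \<and>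
    Mat m n B = mat_mult_over R (mat_mult_over R P (Mat m n A)) Q"
  using assms(1)
proof (induction rule: ops.induct)
  case refl
  show ?case
    using one_mat_invertible mat_mult_one[OF Mat_mats_over[OF assms(2), of m n]] by metis
next
  case (row B i j T S)
  then obtain P Q where PQ: "invertible_mat_over R m P" "invertible_mat_over R n Q"
    "Mat m n B = mat_mult_over R (mat_mult_over R P (Mat m n A)) Q" by blast
  let ?E = "Mat m m (rowop i j T delta)"
  have E: "invertible_mat_over R m ?E" using rowop_invertible row.hyps by simp
  have o: "?E \<in> mats_over R m m" "P \<in> mats_over R m m" "Q \<in> mats_over R n n"
    "Mat m n A \<in> mats_over R m n"
    using E PQ Mat_mats_over[OF assms(2)] by (simp_all add: invertible_mat_over_def)
  have "Mat m n (rowop i j T B) = mat_mult_over R ?E (Mat m n B)"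
    using rowop_Mat[OF row.hyps(5) ops_entries[OF row.hyps(1) assms(2)], of i m j n] row.hyps by simp
  also have "\<dots> = mat_mult_over R (mat_mult_over R (mat_mult_over R ?E P) (Mat m n A)) Q"
    unfolding PQ(3)
    using mat_mult_assoc[OF o(1) mat_mult_mats_over[OF o(2,4)] o(3)] mat_mult_assoc[OF o(1,2,4)] by simp
  finally show ?case using invertible_mat_mult[OF E PQ(1)] PQ(2) by blast
next
  case (col B i j T S)
  then obtain P Q where PQ: "invertible_mat_over R m P" "invertible_mat_over R n Q"
    "Mat m n B = mat_mult_over R (mat_mult_over R P (Mat m n A)) Q" by blast
  let ?E = "Mat n n (colop i j T delta)"
  have E: "invertible_mat_over R n ?E" using colop_invertible col.hyps by simp
  have o: "?E \<in> mats_over R n n" "mat_mult_over R P (Mat m n A) \<in> mats_over R m n" "Q \<in> mats_over R n n"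
    using E PQ Mat_mats_over[OF assms(2), of m n] mat_mult_mats_over[of P m m]
    by (auto simp add: invertible_mat_over_def)
  have "Mat m n (colop i j T B) = mat_mult_over R (Mat m n B) ?E"
    using colop_Mat[OF col.hyps(5) ops_entries[OF col.hyps(1) assms(2)], of i n j m] col.hyps by simp
  also have "\<dots> = mat_mult_over R (mat_mult_over R P (Mat m n A)) (mat_mult_over R Q ?E)"
    unfolding PQ(3) by (rule mat_mult_assoc[OF o(2,3,1)])
  finally show ?case using invertible_mat_mult[OF PQ(2) E] PQ(1) by blast
qed

lemma gelfand_elementary_divisor_ring:
  assumes G: "gelfand_range_1 R" shows "elementary_divisor_ring R"
  unfolding elementary_divisor_ring_def
proof (intro conjI ring_axioms allI ballI)
  fix m n X assume "X \<in> mats_over R m n"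
  then obtain A where A: "entries A" "X = Mat m n A" by (rule mats_overE)
  obtain D where D: "ops m n 0 0 A D" "\<And>x y. \<lbrakk>x < m; y < n; x \<noteq> y\<rbrakk> \<Longrightarrow> D x y = \<zero>"
    "\<And>i. Suc i < min m n \<Longrightarrow> D i i \<rightharpoonup> D (Suc i) (Suc i)"
    using diagonal_ops[OF G A(1), of m n] by metis
  obtain P Q where PQ: "invertible_mat_over R m P" "invertible_mat_over R n Q"
    "Mat m n D = mat_mult_over R (mat_mult_over R P X) Q"
    using ops_equivalent[OF D(1) A(1)] A(2) by auto
  \<comment> \<open>\<open>xR\<close> is a two-sided ideal contained in \<open>Rx\<close>, so both
    contain the ideal generated by a multiple \<open>y\<close> of \<open>x\<close>.\<close>
  have "Idl {y} \<subseteq> (x <# carrier R) \<inter> (carrier R #> x)" if xy: "x \<rightharpoonup> y" for x y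
  proof -
    have "Idl {y} \<subseteq> {a. x \<rightharpoonup> a}"
      using rdvd_ideal rdvd_carrier[OF xy] xy by (intro genideal_minimal) auto
    also have "\<dots> \<subseteq> (x <# carrier R) \<inter> (carrier R #> x)"
      by (auto simp: l_coset_def r_coset_def elim: rdvdE left_quotient)
    finally show ?thesis .
  qed
  then have "diagonal_divisor_mat R (Mat m n D)"
    unfolding diagonal_divisor_mat_def using D(2,3) by simp
  then show "admits_diagonal_reduction R X"
    unfolding admits_diagonal_reduction_def using PQ A(2) by (intro exI[of _ P] exI[of _ Q]) simp
qed

end

section \<open>Elementwise axioms from the ideal-theoretic hypotheses\<close>

lemma bezout_duo_domain_imp_bezout_duo:
  fixes R (structure)
  assumes "bezout_duo_domain R" shows "bezout_duo R"
proof -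
  interpret ring R using assms by (simp add: bezout_duo_domain_def bezout_ring_def)
  have B: "\<exists>a\<in>carrier R. right_ideal_gen R S = a <# carrier R" if "finite S" "S \<subseteq> carrier R" for S
    using assms that unfolding bezout_duo_domain_def bezout_ring_def by blast
  \<comment> \<open>Principal one-sided ideals become two-sided by the duo property; hence
    \<open>x a\<close> lies in \<open>aR\<close> and \<open>a x\<close> in
    \<open>Ra\<close>.\<close>
  have pr: "right_ideal (a <# carrier R) R" if "a \<in> carrier R" for a
    unfolding right_ideal_def additive_subgroup_def
  proof (intro conjI ring_axioms add.subgroupI ballI)
    fix x y assume "x \<in> a <# carrier R" "y \<in> a <# carrier R"
    then show "x \<oplus> y \<in> a <# carrier R"
      using that unfolding l_coset_def by (auto simp flip: r_distr)
  next
    fix x assume "x \<in> a <# carrier R"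
    then show "\<ominus> x \<in> a <# carrier R"
      using that unfolding l_coset_def by (auto simp flip: r_minus)
  next
    fix x y assume "x \<in> a <# carrier R" "y \<in> carrier R"
    then show "x \<otimes> y \<in> a <# carrier R"
      using that unfolding l_coset_def by (auto simp: m_assoc)
  qed (use that in \<open>auto simp: l_coset_def\<close>)
  have pl: "left_ideal (carrier R #> a) R" if "a \<in> carrier R" for a
    unfolding left_ideal_def additive_subgroup_def
  proof (intro conjI ring_axioms add.subgroupI ballI)
    fix x y assume "x \<in> carrier R #> a" "y \<in> carrier R #> a"
    then show "x \<oplus> y \<in> carrier R #> a"
      using that unfolding r_coset_def by (auto simp flip: l_distr)
  next
    fix x assume "x \<in> carrier R #> a"
    then show "\<ominus> x \<in> carrier R #> a"
      using that unfolding r_coset_def by (auto simp flip: l_minus)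
  next
    fix x y assume "x \<in> carrier R #> a" "y \<in> carrier R"
    then show "y \<otimes> x \<in> carrier R #> a"
      using that unfolding r_coset_def by (auto simp flip: m_assoc)
  qed (use that in \<open>auto simp: r_coset_def\<close>)
  have ir: "ideal (a <# carrier R) R" if "a \<in> carrier R" for a
    using pr[OF that] assms unfolding bezout_duo_domain_def duo_ring_def by blast
  have il: "ideal (carrier R #> a) R" if "a \<in> carrier R" for a
    using pl[OF that] assms unfolding bezout_duo_domain_def duo_ring_def by blast
  have ar: "a \<in> a <# carrier R" and al: "a \<in> carrier R #> a" if "a \<in> carrier R" for a
    using that by (auto simp: l_coset_def r_coset_def intro!: bexI[of _ \<one>])
  show ?thesis
  proof unfold_locales
    fix a x assume ax: "a \<in> carrier R" "x \<in> carrier R"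
    have "x \<otimes> a \<in> a <# carrier R" using ideal.I_l_closed[OF ir ar] ax by blast
    then show "\<exists>y\<in>carrier R. x \<otimes> a = a \<otimes> y" by (auto simp: l_coset_def)
    have "a \<otimes> x \<in> carrier R #> a" using ideal.I_r_closed[OF il al] ax by blast
    then show "\<exists>y\<in>carrier R. a \<otimes> x = y \<otimes> a" by (auto simp: r_coset_def)
  next
    fix a b assume "a \<in> carrier R" "b \<in> carrier R" "a \<otimes> b = \<zero>"
    then show "a = \<zero> \<or> b = \<zero>" using assms unfolding bezout_duo_domain_def nc_domain_def by blast
  next
    fix a b assume ab: "a \<in> carrier R" "b \<in> carrier R"
    then obtain d where d: "d \<in> carrier R" "right_ideal_gen R {a, b} = d <# carrier R"
      using B[of "{a, b}"] by auto
    have "a \<in> d <# carrier R" "b \<in> d <# carrier R"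
      unfolding d(2)[symmetric] right_ideal_gen_def by auto
    then obtain r s where rs: "r \<in> carrier R" "s \<in> carrier R" "a = d \<otimes> r" "b = d \<otimes> s"
      by (auto simp: l_coset_def)
    \<comment> \<open>As a right ideal containing \<open>a\<close> and \<open>b\<close>, this sum
      contains the generator \<open>d\<close>, which yields the Bezout coefficients.\<close>
    let ?I = "(a <# carrier R) <+>\<^bsub>R\<^esub> (b <# carrier R)"
    have I: "ideal ?I R" using add_ideals[OF ir ir] ab by blast
    then have "right_ideal ?I R"
      by (simp add: right_ideal_def ring_axioms ideal.axioms(1) ideal.I_r_closed)
    moreover have mem: "a \<otimes> x \<oplus> b \<otimes> y \<in> ?I" if "x \<in> carrier R" "y \<in> carrier R" for x y
      using that unfolding set_add_def' l_coset_def by blast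
    have "a \<in> ?I" "b \<in> ?I" using mem[of \<one> \<zero>] mem[of \<zero> \<one>] ab by simp_all
    ultimately have "right_ideal_gen R {a, b} \<subseteq> ?I" unfolding right_ideal_gen_def by blast
    then have "d \<in> ?I" using ar[OF d(1)] d(2) by blast
    then obtain x y where "x \<in> carrier R" "y \<in> carrier R" "a \<otimes> x \<oplus> b \<otimes> y = d"
      unfolding set_add_def' l_coset_def by auto
    then show "\<exists>d\<in>carrier R. \<exists>r\<in>carrier R. \<exists>s\<in>carrier R. \<exists>x\<in>carrier R. \<exists>y\<in>carrier R.
        a = d \<otimes> r \<and> b = d \<otimes> s \<and> a \<otimes> x \<oplus> b \<otimes> y = d"
      using d(1) rs by blast
  qed
qed

theorem theorem4p3:
  fixes R :: "('a, 'b) ring_scheme"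
  assumes "bezout_duo_domain R"
    and "gelfand_range_1 R"
  shows "elementary_divisor_ring R"
  using bezout_duo.gelfand_elementary_divisor_ring[OF bezout_duo_domain_imp_bezout_duo] assms by blast

end
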